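(* Let $\lambda$ be a partition. Then $\Phi:\mathrm{Tab}_\lambda\to\mathrm{RPP}_\lambda$ and $\xi_\lambda:\mathrm{RPP}_\lambda\to\mathrm{Tab}_\lambda$ are mutually inverse bijections.
   Context: Cells are pairs $(i,j)\in\mathbb Z^2$; $\mathrm n(i,j)=(i-1,j)$, $\mathrm e(i,j)=(i,j+1)$, $\mathrm s(i,j)=(i+1,j)$, $\mathrm w(i,j)=(i,j-1)$. A partition $\nu$ is identified with its Young diagram; $\nu'$ is its conjugate. A reverse plane partition of shape $\nu$ is $\pi:\nu\to\mathbb N$ with $\pi(u)\le\pi(\mathrm e u),\pi(\mathrm s u)$, with conventions $\pi(i,j)=0$ if $i\le0$ or $j\le0$, $\pi(i,j)=\infty$ if $i,j\ge1$, $(i,j)\notin\nu$; $\mathrm{RPP}_\nu$ is the set of them, $0$ the zero one. $\mathrm{Tab}_\nu$ is the set of all maps $t:\nu\to\mathbb N$. Content $c(i,j)=j-i$. Outer corner of $\nu$: $u\in\nu$ with $\mathrm e u,\mathrm s u\notin\nu$; inner corner: $\mathrm e u,\mathrm s u\in\nu$, $\mathrm e\mathrm s u\notin\nu$. With inner corner contents $i_1<\dots<i_r$ and outer corner contents $o_1<\dots<o_{r+1}$ (interlacing), $\mathcal I=\{u\in\nu:c(u)=i_k\}$, $\mathcal O=\{u\in\nu:c(u)=o_k\}$, $\mathcal A=\{u\in\nu:c(u)<o_1\text{ or }i_k<c(u)<o_{k+1}\text{ for some }k\in[r]\}$, $\mathcal B=\{u\in\nu:o_k<c(u)<i_k\text{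 for some }k\in[r]\text{ or }c(u)>o_{r+1}\}$. North-east path: $(u_0,\dots,u_s)$ in $\nu$, $u_k\in\{\mathrm n u_{k-1},\mathrm e u_{k-1}\}$, length $s$, head $\alpha=u_0$, tail $\omega=u_s$; south-west path $(v_0,\dots,v_s)$, $v_k\in\{\mathrm s v_{k-1},\mathrm w v_{k-1}\}$, $\alpha=v_s$, $\omega=v_0$. Rim-hook: north-east path $h$ with $\mathrm s\alpha(h)\notin\nu$, $\mathrm e\omega(h)\notin\nu$, $\mathrm e\mathrm s u\notin\nu$ for $u\in h$; for $u=(i,j)\in\nu$, $h^u$ is the rim-hook from $(\nu'_j,j)$ to $(i,\nu_i)$. Reverse lexicographic order: $(i,j)\le(k,l)$ iff $j>l$, or $j=l$ and $i\ge k$; $h^u\le h^v$ iff $u\le v$. Insertion: $(\pi+P)(u)=\pi(u)+1$ for $u\in P$, else $\pi(u)$; $(P,\pi)$ compatible if $u\in P\cap(\mathcal I\cup\mathcal A)$ implies $\mathrm e u\in P$ and $\pi(u)=\pi(\mathrm e u)$, and $u,\mathrm s u\in P$ implies $\pi(u)=\pi(\mathrm s u)$. $h$ inserts into $\pi$ if some path $P$ has $\omega(P)=\omega(h)$, $\ell(P)=\ell(h)$, $(P,\pi)$ compatible and $\pi+P$ a reverse plane partition; then $h*\pi=\pi+P(h,\pi)$, where $P(h,\pi)$ is the south-west path from $\omega(h)$ which, while its length is less than $\ell(h)$, moves from current $u$ to $\mathrm s u$ if $u\in\mathcal B\cup\mathcal I$ and $\pi(u)=\pi(\mathrm s u)$,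 else to $\mathrm w u$. $\Phi:\mathrm{Tab}_\lambda\to\mathrm{RPP}_\lambda$: for $t$, take the multiset containing $t(u)$ copies of $h^u$ for each $u\in\lambda$, list it as $h_1\le\dots\le h_s$, and set $\Phi(t)=h_1*(h_2*(\cdots(h_s*0)))$ (these insertions are always defined). For an outer corner $x$ of $\lambda$ and $\mu=\lambda\setminus\{x\}$, $\zeta_{\lambda,x}:\mathrm{RPP}_\lambda\to\mathrm{RPP}_\mu$ is $\zeta_{\lambda,x}(\pi)(u)=\max\{\pi(\mathrm n u),\pi(\mathrm w u)\}+\min\{\pi(\mathrm e u),\pi(\mathrm s u)\}-\pi(u)$ if $c(u)=c(x)$, and $\pi(u)$ otherwise ($u\in\mu$). $\xi_\lambda:\mathrm{RPP}_\lambda\to\mathrm{Tab}_\lambda$ is defined recursively (with $\xi_\emptyset$ trivial): for any outer corner $x$, $\xi_\lambda(\pi)(x)=\pi(x)-\max\{\pi(\mathrm n x),\pi(\mathrm w x)\}$ and $\xi_\lambda(\pi)(u)=\xi_\mu(\zeta_{\lambda,x}(\pi))(u)$ for $u\in\mu$; this is known (Pak) to be independent of the choice of $x$. *)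

theory Defs
  imports Main "HOL-Library.Extended_Nat" "HOL-Library.FuncSet" "HOL-Library.Multiset"
begin

type_synonym cell = "int \<times> int"

text \<open>Matrix coordinates: rows grow southwards, columns grow eastwards.\<close>

fun north :: "cell \<Rightarrow> cell" where "north (i, j) = (i - 1, j)"
fun east :: "cell \<Rightarrow> cell" where "east (i, j) = (i, j + 1)"
fun south :: "cell \<Rightarrow> cell" where "south (i, j) = (i + 1, j)"
fun west :: "cell \<Rightarrow> cell" where "west (i, j) = (i, j - 1)"

fun content :: "cell \<Rightarrow> int" where "content (i, j) = j - i"

definition is_partition :: "nat list \<Rightarrow> bool" where
  "is_partition p \<longleftrightarrow> sorted_wrt (\<ge>) p \<and> (\<forall>a\<in>set p. a > 0)"

definition diagram :: "nat list \<Rightarrow> cell set" where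
  "diagram p = {(i, j). 1 \<le> i \<and> i \<le> int (length p) \<and> 1 \<le> j \<and> j \<le> int (p ! nat (i - 1))}"

text \<open>From here on a partition is represented by its Young diagram \<open>\<nu>\<close>; the next two
  definitions recover its parts and the parts of its conjugate.\<close>

definition row_len :: "cell set \<Rightarrow> int \<Rightarrow> int" where
  "row_len \<nu> i = int (card {j. (i, j) \<in> \<nu>})"

definition col_len :: "cell set \<Rightarrow> int \<Rightarrow> int" where
  "col_len \<nu> j = int (card {i. (i, j) \<in> \<nu>})"

text \<open>Maps on \<open>\<nu>\<close> are extensional functions: they take the value \<open>undefined\<close> outside \<open>\<nu>\<close>.\<close>

definition Tab :: "cell set \<Rightarrow> (cell \<Rightarrow> nat) set" where
  "Tab \<nu> = (\<nu> \<rightarrow>\<^sub>E UNIV)"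

text \<open>\<open>val \<nu> \<pi>\<close> extends \<open>\<pi>\<close> to all cells by the boundary conventions.\<close>

definition val :: "cell set \<Rightarrow> (cell \<Rightarrow> nat) \<Rightarrow> cell \<Rightarrow> enat" where
  "val \<nu> \<pi> u = (if fst u \<le> 0 \<or> snd u \<le> 0 then 0 else if u \<in> \<nu> then enat (\<pi> u) else \<infinity>)"

definition RPP :: "cell set \<Rightarrow> (cell \<Rightarrow> nat) set" where
  "RPP \<nu> = {\<pi> \<in> Tab \<nu>. \<forall>u\<in>\<nu>. val \<nu> \<pi> u \<le> val \<nu> \<pi> (east u) \<and> val \<nu> \<pi> u \<le> val \<nu> \<pi> (south u)}"

definition zero_rpp :: "cell set \<Rightarrow> cell \<Rightarrow> nat" where
  "zero_rpp \<nu> = (\<lambda>u\<in>\<nu>. 0)"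

definition outer_corner :: "cell set \<Rightarrow> cell \<Rightarrow> bool" where
  "outer_corner \<nu> u \<longleftrightarrow> u \<in> \<nu> \<and> east u \<notin> \<nu> \<and> south u \<notin> \<nu>"

definition inner_corner :: "cell set \<Rightarrow> cell \<Rightarrow> bool" where
  "inner_corner \<nu> u \<longleftrightarrow> u \<in> \<nu> \<and> east u \<in> \<nu> \<and> south u \<in> \<nu> \<and> east (south u) \<notin> \<nu>"

definition outer_contents :: "cell set \<Rightarrow> int list" where
  "outer_contents \<nu> = sorted_list_of_set (content ` {u. outer_corner \<nu> u})"

definition inner_contents :: "cell set \<Rightarrow> int list" where
  "inner_contents \<nu> = sorted_list_of_set (content ` {u. inner_corner \<nu> u})"

text \<open>List positions start at 0: \<open>outer_contents \<nu> ! k\<close> is $o_{k+1}$ and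
  \<open>inner_contents \<nu> ! k\<close> is $i_{k+1}$.\<close>

definition region_I :: "cell set \<Rightarrow> cell set" where
  "region_I \<nu> = {u \<in> \<nu>. content u \<in> set (inner_contents \<nu>)}"

definition region_A :: "cell set \<Rightarrow> cell set" where
  "region_A \<nu> = {u \<in> \<nu>. content u < outer_contents \<nu> ! 0 \<or>
     (\<exists>k<length (inner_contents \<nu>).
        inner_contents \<nu> ! k < content u \<and> content u < outer_contents \<nu> ! (k + 1))}"

definition region_B :: "cell set \<Rightarrow> cell set" where
  "region_B \<nu> = {u \<in> \<nu>.
     (\<exists>k<length (inner_contents \<nu>).
        outer_contents \<nu> ! k < content u \<and> content u < inner_contents \<nu> ! k) \<or>
     content u > outer_contents \<nu> ! length (inner_contents \<nu>)}"

text \<open>The head \<open>\<alpha>\<close> and tail \<open>\<omega>\<close> are \<open>hd\<close> and \<open>last\<close> of a north-east path, but \<open>last\<close> and \<open>hd\<close>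
  of a south-west path.\<close>

definition ne_path :: "cell set \<Rightarrow> cell list \<Rightarrow> bool" where
  "ne_path \<nu> p \<longleftrightarrow> p \<noteq> [] \<and> set p \<subseteq> \<nu> \<and>
     (\<forall>k. Suc k < length p \<longrightarrow> p ! Suc k \<in> {north (p ! k), east (p ! k)})"

definition sw_path :: "cell set \<Rightarrow> cell list \<Rightarrow> bool" where
  "sw_path \<nu> p \<longleftrightarrow> p \<noteq> [] \<and> set p \<subseteq> \<nu> \<and>
     (\<forall>k. Suc k < length p \<longrightarrow> p ! Suc k \<in> {south (p ! k), west (p ! k)})"

definition path_len :: "cell list \<Rightarrow> nat" where
  "path_len p = length p - 1"

definition rim_hook :: "cell set \<Rightarrow> cell list \<Rightarrow> bool" where
  "rim_hook \<nu> h \<longleftrightarrow> ne_path \<nu> h \<and> south (hd h) \<notin> \<nu> \<and> east (last h) \<notin> \<nu> \<and>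
     (\<forall>u\<in>set h. east (south u) \<notin> \<nu>)"

definition hook_at :: "cell set \<Rightarrow> cell \<Rightarrow> cell list" where
  "hook_at \<nu> u = (THE h. rim_hook \<nu> h \<and>
     hd h = (col_len \<nu> (snd u), snd u) \<and> last h = (fst u, row_len \<nu> (fst u)))"

fun revlex_le :: "cell \<Rightarrow> cell \<Rightarrow> bool" where
  "revlex_le (i, j) (k, l) \<longleftrightarrow> j > l \<or> (j = l \<and> i \<ge> k)"

definition hook_le :: "cell set \<Rightarrow> cell list \<Rightarrow> cell list \<Rightarrow> bool" where
  "hook_le \<nu> g h \<longleftrightarrow> (\<exists>u\<in>\<nu>. \<exists>v\<in>\<nu>. g = hook_at \<nu> u \<and> h = hook_at \<nu> v \<and> revlex_le u v)"

definition add_path :: "cell set \<Rightarrow> (cell \<Rightarrow> nat) \<Rightarrow> cell list \<Rightarrow> cell \<Rightarrow> nat" where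
  "add_path \<nu> \<pi> P = (\<lambda>u\<in>\<nu>. if u \<in> set P then \<pi> u + 1 else \<pi> u)"

definition compatible :: "cell set \<Rightarrow> cell list \<Rightarrow> (cell \<Rightarrow> nat) \<Rightarrow> bool" where
  "compatible \<nu> P \<pi> \<longleftrightarrow>
     (\<forall>u \<in> set P \<inter> (region_I \<nu> \<union> region_A \<nu>). east u \<in> set P \<and> val \<nu> \<pi> u = val \<nu> \<pi> (east u)) \<and>
     (\<forall>u. u \<in> set P \<and> south u \<in> set P \<longrightarrow> val \<nu> \<pi> u = val \<nu> \<pi> (south u))"

text \<open>Reversal turns south-west paths into north-east ones and preserves head, tail, length and
  cells, so it does not matter which kind is quantified over here.\<close>

definition inserts :: "cell set \<Rightarrow> cell list \<Rightarrow> (cell \<Rightarrow> nat) \<Rightarrow> bool" where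
  "inserts \<nu> h \<pi> \<longleftrightarrow> (\<exists>P. sw_path \<nu> P \<and> hd P = last h \<and> path_len P = path_len h \<and>
     compatible \<nu> P \<pi> \<and> add_path \<nu> \<pi> P \<in> RPP \<nu>)"

fun walk :: "cell set \<Rightarrow> (cell \<Rightarrow> nat) \<Rightarrow> nat \<Rightarrow> cell \<Rightarrow> cell list" where
  "walk \<nu> \<pi> 0 u = [u]"
| "walk \<nu> \<pi> (Suc k) u = u # walk \<nu> \<pi> k
     (if u \<in> region_B \<nu> \<union> region_I \<nu> \<and> val \<nu> \<pi> u = val \<nu> \<pi> (south u) then south u else west u)"

definition insertion_path :: "cell set \<Rightarrow> cell list \<Rightarrow> (cell \<Rightarrow> nat) \<Rightarrow> cell list" where
  "insertion_path \<nu> h \<pi> = walk \<nu> \<pi> (path_len h) (last h)"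

definition insert_hook :: "cell set \<Rightarrow> cell list \<Rightarrow> (cell \<Rightarrow> nat) \<Rightarrow> cell \<Rightarrow> nat" where
  "insert_hook \<nu> h \<pi> =
     (if inserts \<nu> h \<pi> then add_path \<nu> \<pi> (insertion_path \<nu> h \<pi>) else undefined)"

definition hook_list :: "cell set \<Rightarrow> (cell \<Rightarrow> nat) \<Rightarrow> cell list list" where
  "hook_list \<nu> t = (THE hs. mset hs = (\<Sum>u\<in>\<nu>. replicate_mset (t u) (hook_at \<nu> u)) \<and>
     sorted_wrt (hook_le \<nu>) hs)"

definition Phi :: "cell set \<Rightarrow> (cell \<Rightarrow> nat) \<Rightarrow> cell \<Rightarrow> nat" where
  "Phi \<nu> t = foldr (insert_hook \<nu>) (hook_list \<nu> t) (zero_rpp \<nu>)"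

text \<open>For a reverse plane partition of shape \<open>\<nu>\<close> and an outer corner \<open>x\<close>, all values occurring in
  the differences below are finite and no subtraction is truncated.\<close>

definition zeta :: "cell set \<Rightarrow> cell \<Rightarrow> (cell \<Rightarrow> nat) \<Rightarrow> cell \<Rightarrow> nat" where
  "zeta \<nu> x \<pi> = (\<lambda>u \<in> \<nu> - {x}.
     if content u = content x
     then the_enat (max (val \<nu> \<pi> (north u)) (val \<nu> \<pi> (west u))
            + min (val \<nu> \<pi> (east u)) (val \<nu> \<pi> (south u)) - val \<nu> \<pi> u)
     else \<pi> u)"

text \<open>\<open>xi_rel \<nu> \<pi> t\<close>: some order of removing outer corners one by one yields the tableau \<open>t\<close>.
  The result does not depend on the order, which makes the description in \<open>xi\<close> unique.\<close>

inductive xi_rel :: "cell set \<Rightarrow> (cell \<Rightarrow> nat) \<Rightarrow> (cell \<Rightarrow> nat) \<Rightarrow> bool" where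
  empty: "xi_rel {} \<pi> (\<lambda>_. undefined)"
| corner: "outer_corner \<nu> x \<Longrightarrow> xi_rel (\<nu> - {x}) (zeta \<nu> x \<pi>) t \<Longrightarrow>
     xi_rel \<nu> \<pi> (t(x := the_enat (val \<nu> \<pi> x - max (val \<nu> \<pi> (north x)) (val \<nu> \<pi> (west x)))))"

definition xi :: "cell set \<Rightarrow> (cell \<Rightarrow> nat) \<Rightarrow> cell \<Rightarrow> nat" where
  "xi \<nu> \<pi> = (THE t. xi_rel \<nu> \<pi> t)"

end

theory Submission
  imports Defs
begin

text \<open>Read along its diagonals, a reverse plane partition is a sequence of partitions, and an
  insertion adds one box to each partition on an interval of diagonals. For every outer corner \<open>x\<close>
  of \<open>\<nu>\<close>, with \<open>\<mu> = \<nu> - {x}\<close>, the map \<open>\<zeta>\<close> together with the excess at \<open>x\<close> is invertible, and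
  \<open>\<Phi>\<close> commutes with it: building a filling of \<open>\<nu>\<close> hook by hook and then applying \<open>\<zeta>\<close> is the same as
  building its restriction to \<open>\<mu>\<close>. This is checked insertion by insertion, where only the
  diagonal of \<open>x\<close> has to be compared. Two invariants make the comparison work, and are inherited
  from \<open>\<mu>\<close> by \<open>\<nu>\<close>: as long as a column has not been used, the partitions on both sides of its
  bottom edge agree; and when a hook of column \<open>j\<close> is inserted, the partitions on both sides of the
  bottom edge of column \<open>j\<close> agree in all rows before the one in which the new box appears.
  Since \<open>x\<close> is arbitrary, the independence of \<open>\<xi>\<close> of the order of corners comes out as well.\<close>

subsection \<open>Young diagrams and rim-hooks\<close>

text \<open>The comparison is local because passing between \<mu> and \<nu> exchanges two adjacent
  boundary steps around the diagonal c of x, while a step of an insertion path reads one boundary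
  step and entries on two adjacent diagonals. That it succeeds is due to the insertion order:
  columns from left to right, and each column from top to bottom. Apart from the hooks of x itself,
  every hook whose path meets one of the diagonals c - 1, c, c + 1 is inserted before the first hook
  of x, while the excess is still 0. Only the hooks above x in its own column require a computation
  with the toggle; there the second invariant leaves just two candidates for the new box. Hooks of x
  only raise the excess, and all remaining hooks miss the three diagonals.\<close>

definition young :: "cell set \<Rightarrow> bool" where
  "young \<nu> \<longleftrightarrow> finite \<nu> \<and> (\<forall>i j. (i, j) \<in> \<nu> \<longrightarrow> 1 \<le> i \<and> 1 \<le> j) \<and>
     (\<forall>i j k l. (i, j) \<in> \<nu> \<longrightarrow> 1 \<le> k \<longrightarrow> k \<le> i \<longrightarrow> 1 \<le> l \<longrightarrow> l \<le> j \<longrightarrow> (k, l) \<in> \<nu>)"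

lemma youngI:
  assumes "finite \<nu>" "\<And>i j. (i, j) \<in> \<nu> \<Longrightarrow> 1 \<le> i \<and> 1 \<le> j"
    "\<And>i j k l. (i, j) \<in> \<nu> \<Longrightarrow> 1 \<le> k \<Longrightarrow> k \<le> i \<Longrightarrow> 1 \<le> l \<Longrightarrow> l \<le> j \<Longrightarrow> (k, l) \<in> \<nu>"
  shows "young \<nu>"
proof -
  have "\<forall>i j. (i, j) \<in> \<nu> \<longrightarrow> 1 \<le> i \<and> 1 \<le> j" using assms(2) by blast
  moreover have "\<forall>i j k l. (i, j) \<in> \<nu> \<longrightarrow> 1 \<le> k \<longrightarrow> k \<le> i \<longrightarrow> 1 \<le> l \<longrightarrow> l \<le> j \<longrightarrow> (k, l) \<in> \<nu>"
    by (intro allI impI) (rule assms(3))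
  ultimately show ?thesis unfolding young_def using assms(1) by (intro conjI)
qed

lemma young_finite: "young \<nu> \<Longrightarrow> finite \<nu>"
  unfolding young_def by (elim conjE)

lemma young_pos:
  assumes "young \<nu>" "(i, j) \<in> \<nu>"
  shows "1 \<le> i \<and> 1 \<le> j"
proof -
  have "\<forall>i j. (i, j) \<in> \<nu> \<longrightarrow> 1 \<le> i \<and> 1 \<le> j" using assms(1) unfolding young_def by (elim conjE)
  then show ?thesis using assms(2) by blast
qed

lemma young_down:
  assumes "young \<nu>" "(i, j) \<in> \<nu>" "1 \<le> k" "k \<le> i" "1 \<le> l" "l \<le> j"
  shows "(k, l) \<in> \<nu>"
proof -
  have "\<forall>i j k l. (i, j) \<in> \<nu> \<longrightarrow> 1 \<le> k \<longrightarrow> k \<le> i \<longrightarrow> 1 \<le> l \<longrightarrow> l \<le> j \<longrightarrow> (k, l) \<in> \<nu>"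
    using assms(1) unfolding young_def by (elim conjE)
  then show ?thesis using assms(2-) by iprover
qed

text \<open>Here the list of parts is left behind. The induction removes cells, and
  \<open>young\<close>, a property of cell sets, survives that directly.\<close>

lemma young_diagram:
  assumes "is_partition p"
  shows "young (diagram p)"
proof -
  have mono: "p ! nat (i - 1) \<le> p ! nat (k - 1)" if "1 \<le> k" "k \<le> i" "i \<le> int (length p)" for i k
  proof (cases "k = i")
    case False
    then have "nat (k - 1) < nat (i - 1)" "nat (i - 1) < length p" using that by auto
    then show ?thesis using assms by (auto simp: is_partition_def sorted_wrt_iff_nth_less)
  qed simp
  have "diagram p \<subseteq> {1..int (length p)} \<times> {1..int (p ! 0)}"
  proof
    fix u assume u: "u \<in> diagram p"
    obtain i j where ij: "u = (i, j)" by fastforce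
    with u have *: "1 \<le> i" "i \<le> int (length p)" "1 \<le> j" "j \<le> int (p ! nat (i - 1))"
      by (simp_all add: diagram_def)
    then have "p ! nat (i - 1) \<le> p ! 0" using mono[of 1 i] by simp
    then have "j \<le> int (p ! 0)" using *(4) by linarith
    then show "u \<in> {1..int (length p)} \<times> {1..int (p ! 0)}" using ij * by simp
  qed
  then have fin: "finite (diagram p)" by (rule finite_subset) simp
  have down: "(k, l) \<in> diagram p"
    if *: "(i, j) \<in> diagram p" "1 \<le> k" "k \<le> i" "1 \<le> l" "l \<le> j" for i j k l
  proof -
    have ij: "i \<le> int (length p)" "j \<le> int (p ! nat (i - 1))" using *(1) by (simp_all add: diagram_def)
    have "int (p ! nat (i - 1)) \<le> int (p ! nat (k - 1))" using mono[OF *(2,3) ij(1)] by simp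
    then have "l \<le> int (p ! nat (k - 1))" using ij(2) *(5) by linarith
    then show ?thesis using *(2,3,4) ij(1) by (simp add: diagram_def)
  qed
  have pos: "1 \<le> i \<and> 1 \<le> j" if "(i, j) \<in> diagram p" for i j using that by (simp add: diagram_def)
  show ?thesis by (rule youngI[OF fin pos down])
qed

text \<open>Rows and columns of a diagram are initial intervals of the positive integers, so the
  cardinalities \<open>row_len\<close> and \<open>col_len\<close> act as bounds for
  membership.\<close>

lemma int_lower_set:
  fixes S :: "int set"
  assumes "finite S" "\<And>s. s \<in> S \<Longrightarrow> 1 \<le> s" "\<And>s k. s \<in> S \<Longrightarrow> 1 \<le> k \<Longrightarrow> k \<le> s \<Longrightarrow> k \<in> S"
  shows "S = {1..int (card S)}"
proof (cases "S = {}")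
  case False
  then have "Max S \<in> S" using assms(1) by (rule Max_in[rotated])
  have *: "S = {1..Max S}"
  proof (intro set_eqI iffI)
    show "s \<in> {1..Max S}" if "s \<in> S" for s using assms(2)[OF that] Max_ge[OF assms(1) that] by simp
    show "s \<in> S" if "s \<in> {1..Max S}" for s using assms(3)[OF \<open>Max S \<in> S\<close>, of s] that by simp
  qed
  have "1 \<le> Max S" using assms(2) \<open>Max S \<in> S\<close> by blast
  then have "int (card {1..Max S}) = Max S" by simp
  then have "int (card S) = Max S" using * by simp
  with * show ?thesis by simp
qed simp

lemma mem_row:
  assumes "young \<nu>"
  shows "(i, j) \<in> \<nu> \<longleftrightarrow> 1 \<le> j \<and> j \<le> row_len \<nu> i"
proof -
  let ?S = "{j. (i, j) \<in> \<nu>}"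
  have "?S = Pair i -` \<nu>" by auto
  then have "finite ?S" using finite_vimageI[OF young_finite[OF assms], of "Pair i"] by (simp add: inj_on_def)
  then have "?S = {1..row_len \<nu> i}" unfolding row_len_def
  proof (rule int_lower_set)
    show "1 \<le> s" if "s \<in> ?S" for s using that young_pos[OF assms] by blast
    show "k \<in> ?S" if "s \<in> ?S" "1 \<le> k" "k \<le> s" for s k
    proof -
      have s: "(i, s) \<in> \<nu>" using that(1) by simp
      then show ?thesis using young_down[OF assms s, of i k] young_pos[OF assms s] that(2,3) by simp
    qed
  qed
  then have "j \<in> ?S \<longleftrightarrow> j \<in> {1..row_len \<nu> i}" by (rule arg_cong)
  then show ?thesis by simp
qed

lemma mem_col:
  assumes "young \<nu>"
  shows "(i, j) \<in> \<nu> \<longleftrightarrow> 1 \<le> i \<and> i \<le> col_len \<nu> j"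
proof -
  let ?S = "{i. (i, j) \<in> \<nu>}"
  have "?S = (\<lambda>i. (i, j)) -` \<nu>" by auto
  then have "finite ?S" using finite_vimageI[OF young_finite[OF assms], of "(\<lambda>i. (i, j))"] by (simp add: inj_on_def)
  then have "?S = {1..col_len \<nu> j}" unfolding col_len_def
  proof (rule int_lower_set)
    show "1 \<le> s" if "s \<in> ?S" for s using that young_pos[OF assms] by blast
    show "k \<in> ?S" if "s \<in> ?S" "1 \<le> k" "k \<le> s" for s k
    proof -
      have s: "(s, j) \<in> \<nu>" using that(1) by simp
      then show ?thesis using young_down[OF assms s, of k j] young_pos[OF assms s] that(2,3) by simp
    qed
  qed
  then have "i \<in> ?S \<longleftrightarrow> i \<in> {1..col_len \<nu> j}" by (rule arg_cong)
  then show ?thesis by simp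
qed

lemma young_remove_corner:
  assumes "young \<nu>" "outer_corner \<nu> x"
  shows "young (\<nu> - {x})"
proof -
  obtain a b where x: "x = (a, b)" by fastforce
  have c: "(a, b) \<in> \<nu>" "(a, b + 1) \<notin> \<nu>" "(a + 1, b) \<notin> \<nu>"
    using assms(2) by (auto simp: outer_corner_def x)
  have ne: "(k, l) \<noteq> (a, b)" if ij: "(i, j) \<in> \<nu> - {(a, b)}" "k \<le> i" "l \<le> j" for i j k l
  proof
    assume kl: "(k, l) = (a, b)"
    have "(i, j) \<in> \<nu>" "1 \<le> a" "1 \<le> b" using ij(1) young_pos[OF assms(1) c(1)] by simp_all
    note down = young_down[OF assms(1) this(1)]
    \<comment> \<open>A cell weakly south-east of x but different from it would drag the southern or
      the eastern neighbour of x into \<nu>.\<close>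
    from ij kl consider "a + 1 \<le> i" "b \<le> j" | "a \<le> i" "b + 1 \<le> j" by fastforce
    then show False
      using down[of "a + 1" b] down[of a "b + 1"] c \<open>1 \<le> a\<close> \<open>1 \<le> b\<close> by cases simp_all
  qed
  show ?thesis
  proof (rule youngI)
    show "finite (\<nu> - {x})" using young_finite[OF assms(1)] by simp
    show "1 \<le> i \<and> 1 \<le> j" if "(i, j) \<in> \<nu> - {x}" for i j
      using that young_pos[OF assms(1)] by blast
    show "(k, l) \<in> \<nu> - {x}" if "(i, j) \<in> \<nu> - {x}" "1 \<le> k" "k \<le> i" "1 \<le> l" "l \<le> j" for i j k l
      using young_down[OF assms(1) _ that(2-5)] ne[of i j k l] that unfolding x by blast
  qed
qed

text \<open>A cell with maximal sum of coordinates has no neighbour to the east or south.\<close>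

lemma ex_outer_corner:
  assumes "young \<nu>" "\<nu> \<noteq> {}"
  obtains x where "outer_corner \<nu> x"
proof -
  define M where "M = Max ((\<lambda>u. fst u + snd u) ` \<nu>)"
  have fin: "finite ((\<lambda>u. fst u + snd u) ` \<nu>)" using young_finite[OF assms(1)] by simp
  then have "M \<in> (\<lambda>u. fst u + snd u) ` \<nu>" unfolding M_def using assms(2) by (intro Max_in) auto
  then obtain i j where u: "(i, j) \<in> \<nu>" "M = i + j" by auto
  have "k + l \<le> M" if "(k, l) \<in> \<nu>" for k l
    unfolding M_def using fin that by (intro Max_ge) (auto intro: rev_image_eqI)
  from this[of i "j + 1"] this[of "i + 1" j] u have "outer_corner \<nu> (i, j)"
    by (auto simp: outer_corner_def)
  then show ?thesis by (rule that)
qed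

text \<open>Of two cells on one diagonal, the upper one has its south-east neighbour weakly
  north-west of the lower one. Rim-hooks consist of last cells of diagonals, which is what makes
  them unique.\<close>

lemma diag_last_unique:
  assumes "young \<nu>" "u \<in> \<nu>" "v \<in> \<nu>" "east (south u) \<notin> \<nu>" "east (south v) \<notin> \<nu>" "content u = content v"
  shows "u = v"
proof -
  obtain i j k l where uv: "u = (i, j)" "v = (k, l)" by fastforce
  have pos: "1 \<le> i" "1 \<le> j" "1 \<le> k" "1 \<le> l" using assms uv young_pos by auto
  have "i = k"
  proof (rule ccontr)
    assume "i \<noteq> k"
    then consider "i + 1 \<le> k" "j + 1 \<le> l" | "k + 1 \<le> i" "l + 1 \<le> j" using assms(6) uv by fastforce
    then show False
      by cases (use young_down[OF assms(1), of k l "i + 1" "j + 1"] young_down[OF assms(1), of i j "k + 1" "l + 1"]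
          assms uv pos in auto)
  qed
  then show ?thesis using assms(6) uv by auto
qed

lemma content_steps [simp]:
  "content (north u) = content u + 1" "content (east u) = content u + 1"
  "content (south u) = content u - 1" "content (west u) = content u - 1"
  by (cases u; simp)+

lemma ne_path_content:
  assumes "ne_path \<nu> h" "k < length h"
  shows "content (h ! k) = content (hd h) + int k"
  using assms(2)
proof (induction k)
  case 0
  then show ?case by (simp add: hd_conv_nth)
next
  case (Suc k)
  then have "h ! Suc k \<in> {north (h ! k), east (h ! k)}" using assms(1) by (auto simp: ne_path_def)
  then show ?case using Suc by auto
qed

lemma ne_path_length:
  assumes "ne_path \<nu> h"
  shows "int (path_len h) = content (last h) - content (hd h)"
proof -
  have "h \<noteq> []" using assms by (simp add: ne_path_def)
  then show ?thesis using ne_path_content[OF assms, of "length h - 1"]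
    by (simp add: last_conv_nth path_len_def)
qed

lemma rim_hook_unique:
  assumes "young \<nu>" "rim_hook \<nu> g" "rim_hook \<nu> h" "hd g = hd h" "last g = last h"
  shows "g = h"
proof (rule nth_equalityI)
  have ne: "ne_path \<nu> g" "ne_path \<nu> h" using assms by (auto simp: rim_hook_def)
  then have "0 < length g" "0 < length h" by (auto simp: ne_path_def)
  moreover have "int (path_len g) = int (path_len h)"
    unfolding ne_path_length[OF ne(1)] ne_path_length[OF ne(2)] assms(4,5) ..
  ultimately show len: "length g = length h" unfolding path_len_def by linarith
  fix k assume k: "k < length g"
  show "g ! k = h ! k"
  proof (rule diag_last_unique[OF assms(1)])
    show "g ! k \<in> \<nu>" "h ! k \<in> \<nu>" using ne k len by (auto simp: ne_path_def)
    show "east (south (g ! k)) \<notin> \<nu>" "east (south (h ! k)) \<notin> \<nu>"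
      using assms(2,3) k len by (auto simp: rim_hook_def)
    show "content (g ! k) = content (h ! k)"
      using ne_path_content[OF ne(1), of k] ne_path_content[OF ne(2), of k] k len assms(4) by simp
  qed
qed

lemma ne_path_snoc:
  assumes "ne_path \<nu> h" "u \<in> \<nu>" "u \<in> {north (last h), east (last h)}"
  shows "ne_path \<nu> (h @ [u])"
proof -
  have "h \<noteq> []" using assms(1) by (simp add: ne_path_def)
  have "(h @ [u]) ! Suc k \<in> {north ((h @ [u]) ! k), east ((h @ [u]) ! k)}" if "Suc k < length (h @ [u])" for k
  proof (cases "Suc k < length h")
    case True
    then show ?thesis using assms(1) by (auto simp: ne_path_def nth_append)
  next
    case False
    then have "Suc k = length h" using that by simp
    then have "k = length h - 1" by simp
    then show ?thesis using assms(3) \<open>h \<noteq> []\<close> \<open>Suc k = length h\<close> by (simp add: nth_append last_conv_nth)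
  qed
  then show ?thesis using assms(1,2) unfolding ne_path_def by auto
qed

text \<open>The path is traced backwards from u: the predecessor is the southern neighbour if that
  is a cell, and otherwise the western one. Either way it is again the last cell of its
  diagonal.\<close>

lemma rim_path_exists:
  assumes "young \<nu>" "p \<in> \<nu>" "south p \<notin> \<nu>"
  shows "u \<in> \<nu> \<Longrightarrow> east (south u) \<notin> \<nu> \<Longrightarrow> content u = content p + int n \<Longrightarrow>
    \<exists>h. ne_path \<nu> h \<and> (\<forall>v\<in>set h. east (south v) \<notin> \<nu>) \<and> hd h = p \<and> last h = u"
proof (induction n arbitrary: u)
  case 0
  obtain i j where p: "p = (i, j)" by fastforce
  have "east (south p) \<notin> \<nu>" using assms young_down[OF assms(1), of "i + 1" "j + 1" "i + 1" j]
      young_pos[OF assms(1), of i j] by (auto simp: p)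
  then have "u = p" using diag_last_unique[OF assms(1)] 0 assms by auto
  then show ?case using 0 by (intro exI[of _ "[u]"]) (auto simp: ne_path_def)
next
  case (Suc n)
  obtain i j k l where pu: "p = (k, l)" "u = (i, j)" by fastforce
  have pos: "1 \<le> i" "1 \<le> j" "1 \<le> k" "1 \<le> l" 
    using young_pos[OF assms(1), of i j] young_pos[OF assms(1), of k l] assms(2) Suc.prems(1) pu by simp_all
  define v where "v = (if south u \<in> \<nu> then south u else west u)"
  have "west u \<in> \<nu>" if "south u \<notin> \<nu>"
  proof -
    \<comment> \<open>In column 1 the smaller content of p would put p in a lower row than u, and
      then the southern neighbour of u would be a cell.\<close>
    have "j \<noteq> 1"
    proof
      assume "j = 1"
      then have "i + 1 \<le> k" using Suc.prems(3) pu pos by simp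
      then show False using young_down[OF assms(1), of k l "i + 1" 1] assms(2) pu pos that \<open>j = 1\<close> by auto
    qed
    then show ?thesis using young_down[OF assms(1), of i j i "j - 1"] Suc.prems(1) pu pos by auto
  qed
  then have v: "v \<in> \<nu>" by (auto simp: v_def)
  have "east (south v) \<notin> \<nu>"
    using Suc.prems(1,2) young_down[OF assms(1), of "i + 1 + 1" "j + 1" "i + 1" "j + 1"] pos
    by (auto simp: v_def pu)
  moreover have "content v = content p + int n" using Suc.prems(3) by (auto simp: v_def)
  ultimately obtain h where h: "ne_path \<nu> h" "\<forall>v\<in>set h. east (south v) \<notin> \<nu>" "hd h = p" "last h = v"
    using Suc.IH v by blast
  have "u \<in> {north (last h), east (last h)}" unfolding h by (auto simp: v_def pu)
  then have "ne_path \<nu> (h @ [u])" using ne_path_snoc h Suc.prems by blast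
  moreover have "h \<noteq> []" using h(1) by (simp add: ne_path_def)
  ultimately show ?case using h Suc.prems by (intro exI[of _ "h @ [u]"]) auto
qed

text \<open>Existence and uniqueness together evaluate the \<open>THE\<close> in
  \<open>hook_at\<close>.\<close>

lemma hook_at_rim_hook:
  assumes "young \<nu>" "(i, j) \<in> \<nu>"
  shows "rim_hook \<nu> (hook_at \<nu> (i, j))" (is ?rim)
    and "hd (hook_at \<nu> (i, j)) = (col_len \<nu> j, j)" (is ?hd)
    and "last (hook_at \<nu> (i, j)) = (i, row_len \<nu> i)" (is ?last)
proof -
  let ?p = "(col_len \<nu> j, j)" and ?w = "(i, row_len \<nu> i)"
  note row = mem_row[OF assms(1)] and col = mem_col[OF assms(1)]
  have ij: "1 \<le> i" "1 \<le> j" "i \<le> col_len \<nu> j" "j \<le> row_len \<nu> i"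
    using assms(2) row[of i j] col[of i j] by auto
  have p: "?p \<in> \<nu>" "south ?p \<notin> \<nu>" using ij by (simp_all add: col)
  have w: "?w \<in> \<nu>" "east ?w \<notin> \<nu>" using ij by (simp_all add: row)
  have "east (south ?w) \<notin> \<nu>"
    using w(2) ij young_down[OF assms(1), of "i + 1" "row_len \<nu> i + 1" i "row_len \<nu> i + 1"] by auto
  moreover have "content ?w = content ?p + int (nat (content ?w - content ?p))" using ij by simp
  ultimately obtain h where "ne_path \<nu> h" "\<forall>v\<in>set h. east (south v) \<notin> \<nu>" "hd h = ?p" "last h = ?w"
    using rim_path_exists[OF assms(1) p w(1)] by blast
  then have "rim_hook \<nu> h \<and> hd h = ?p \<and> last h = ?w" using p w by (simp add: rim_hook_def)
  moreover have "g = h" if "rim_hook \<nu> g \<and> hd g = ?p \<and> last g = ?w"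
    and "rim_hook \<nu> h \<and> hd h = ?p \<and> last h = ?w" for g h
    using rim_hook_unique[OF assms(1)] that by metis
  ultimately have "\<exists>!h. rim_hook \<nu> h \<and> hd h = ?p \<and> last h = ?w" by blast
  from theI'[OF this] show ?rim ?hd ?last by (simp_all add: hook_at_def)
qed

text \<open>An insertion path of this length has one cell on each diagonal from
  \<open>j - col_len \<nu> j\<close> to \<open>row_len \<nu> i - i\<close>.\<close>

lemma path_len_hook_at:
  assumes "young \<nu>" "(i, j) \<in> \<nu>"
  shows "int (path_len (hook_at \<nu> (i, j))) = (row_len \<nu> i - i) - (j - col_len \<nu> j)"
  using ne_path_length[of \<nu> "hook_at \<nu> (i, j)"] hook_at_rim_hook[OF assms] by (auto simp: rim_hook_def)

text \<open>The head determines the column and the tail the row. Order and multiplicity of hooks can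
  therefore be treated on cells.\<close>

lemma inj_on_hook_at:
  assumes "young \<nu>"
  shows "inj_on (hook_at \<nu>) \<nu>"
proof (rule inj_onI)
  fix u v assume uv: "u \<in> \<nu>" "v \<in> \<nu>" "hook_at \<nu> u = hook_at \<nu> v"
  obtain i j k l where "u = (i, j)" "v = (k, l)" by fastforce
  then show "u = v" using uv hook_at_rim_hook(2,3)[OF assms] by (metis Pair_inject)
qed

subsection \<open>The boundary of a diagram\<close>

text \<open>\<open>hor \<nu> d\<close>: the south-east boundary step between the diagonals \<open>d\<close> and \<open>d + 1\<close> is the bottom
  edge of a column. The regions \<open>I\<close>, \<open>A\<close>, \<open>B\<close> only matter through the two steps next to a diagonal.\<close>

definition hor :: "cell set \<Rightarrow> int \<Rightarrow> bool" where
  "hor \<nu> d \<longleftrightarrow> (\<exists>i j. (i, j) \<in> \<nu> \<and> (i + 1, j) \<notin> \<nu> \<and> j - i = d + 1)"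

text \<open>Comparisons with entries of a sorted list become counts, so that the interlacing of
  corner contents reduces to an equation between cardinalities.\<close>

lemma nth_sorted_le_iff:
  fixes S :: "int set"
  assumes "finite S" "k < card S"
  shows "sorted_list_of_set S ! k \<le> d \<longleftrightarrow> k < card {s \<in> S. s \<le> d}"
proof -
  let ?xs = "sorted_list_of_set S"
  have xs: "set ?xs = S" "length ?xs = card S" "distinct ?xs" "sorted ?xs"
    using assms(1) by simp_all
  show ?thesis
  proof
    assume le: "?xs ! k \<le> d"
    have "(!) ?xs ` {..k} \<subseteq> {s \<in> S. s \<le> d}"
    proof
      fix s assume "s \<in> (!) ?xs ` {..k}"
      then obtain m where m: "m \<le> k" "s = ?xs ! m" by auto
      then have "?xs ! m \<le> ?xs ! k" using xs assms(2) by (intro sorted_nth_mono) auto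
      moreover have "?xs ! m \<in> S" using xs assms(2) m nth_mem[of m ?xs] by simp
      ultimately show "s \<in> {s \<in> S. s \<le> d}" using m le by simp
    qed
    moreover have "inj_on ((!) ?xs) {..k}" using xs assms(2) by (intro inj_on_nth) auto
    ultimately have "card {..k} \<le> card {s \<in> S. s \<le> d}"
      using assms(1) by (intro card_inj_on_le) auto
    then show "k < card {s \<in> S. s \<le> d}" by simp
  next
    assume less: "k < card {s \<in> S. s \<le> d}"
    show "?xs ! k \<le> d"
    proof (rule ccontr)
      assume gt: "\<not> ?xs ! k \<le> d"
      have "{s \<in> S. s \<le> d} \<subseteq> (!) ?xs ` {..<k}"
      proof
        fix s assume "s \<in> {s \<in> S. s \<le> d}"
        then have "s \<in> set ?xs" "s \<le> d" using xs by auto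
        then obtain m where m: "m < length ?xs" "s = ?xs ! m" by (auto simp: in_set_conv_nth)
        have "m < k"
        proof (rule ccontr)
          assume "\<not> m < k"
          then have "?xs ! k \<le> ?xs ! m" using xs m by (intro sorted_nth_mono) auto
          then show False using gt m \<open>s \<le> d\<close> by simp
        qed
        then show "s \<in> (!) ?xs ` {..<k}" using m by auto
      qed
      then have "card {s \<in> S. s \<le> d} \<le> card ((!) ?xs ` {..<k})" by (intro card_mono) auto
      also have "\<dots> \<le> k" using card_image_le[of "{..<k}" "(!) ?xs"] by simp
      finally show False using less by simp
    qed
  qed
qed

lemma card_le_step:
  fixes P :: "int set"
  assumes "finite P"
  shows "card {p \<in> P. p \<le> d + 1} = card {p \<in> P. p \<le> d} + (if d + 1 \<in> P then 1 else 0)"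
proof (cases "d + 1 \<in> P")
  case True
  then have "{p \<in> P. p \<le> d + 1} = insert (d + 1) {p \<in> P. p \<le> d}" by auto
  then show ?thesis using assms True by simp
next
  case False
  then have "{p \<in> P. p \<le> d + 1} = {p \<in> P. p \<le> d}"
    by (metis (mono_tags, lifting) add_le_cancel_right order_le_less zle_add1_eq_le zless_add1_eq)
  then show ?thesis using False by simp
qed

text \<open>Reading the boundary of a diagram from south-west to north-east, a downward switch of
  \<open>f\<close> (from horizontal to vertical) is an outer corner and an upward switch an inner one;
  the two kinds alternate.\<close>

locale switches =
  fixes f :: "int \<Rightarrow> bool" and lo hi :: int and Dn Up :: "int set"
  assumes f_lo: "d < lo \<Longrightarrow> f d" and f_hi: "hi \<le> d \<Longrightarrow> \<not> f d"
    and Dn: "Dn = {d. f (d - 1) \<and> \<not> f d}" and Up: "Up = {d. \<not> f (d - 1) \<and> f d}"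
begin

lemma switch_range: "Dn \<subseteq> {lo..hi}" "Up \<subseteq> {lo..hi}"
proof -
  show "Dn \<subseteq> {lo..hi}"
  proof
    fix d assume "d \<in> Dn"
    then show "d \<in> {lo..hi}" using f_lo[of d] f_hi[of "d - 1"] by (auto simp: Dn not_less[symmetric])
  qed
  show "Up \<subseteq> {lo..hi}"
  proof
    fix d assume "d \<in> Up"
    then show "d \<in> {lo..hi}" using f_lo[of "d - 1"] f_hi[of d] by (auto simp: Up not_less[symmetric])
  qed
qed

lemma finite_switches: "finite Dn" "finite Up"
  using switch_range by (auto intro: finite_subset)

lemma count_below:
  "d < lo \<Longrightarrow> card {p \<in> Dn. p \<le> d} = 0" "d < lo \<Longrightarrow> card {p \<in> Up. p \<le> d} = 0"
proof -
  assume d: "d < lo"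
  have "{p \<in> Dn. p \<le> d} = {}" "{p \<in> Up. p \<le> d} = {}" using switch_range d by auto
  then show "card {p \<in> Dn. p \<le> d} = 0" "card {p \<in> Up. p \<le> d} = 0" by (simp_all only: card.empty)
qed

text \<open>Scanning d upwards, f starts true and every switch flips it, so the two kinds alternate,
  beginning with a downward switch.\<close>

lemma switch_count:
  "card {p \<in> Dn. p \<le> d} = card {p \<in> Up. p \<le> d} + (if f d then 0 else 1)"
proof (cases "d < lo")
  case True
  then show ?thesis using count_below[of d] f_lo[of d] by simp
next
  case False
  then have "lo - 1 \<le> d" by simp
  then show ?thesis
  proof (induction d rule: int_ge_induct)
    case base
    then show ?case using count_below[of "lo - 1"] f_lo[of "lo - 1"] by simp
  next
    case (step d)
    show ?case
      unfolding card_le_step[OF finite_switches(1)] card_le_step[OF finite_switches(2)] step.IH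
      by (simp add: Dn Up)
  qed
qed

lemma card_Dn: "card Dn = card Up + 1"
proof -
  have "{p \<in> Dn. p \<le> hi} = Dn" "{p \<in> Up. p \<le> hi} = Up" using switch_range by auto
  then show ?thesis using switch_count[of hi] f_hi[of hi] by simp
qed

lemma count_le_card: "card {p \<in> Up. p \<le> d} \<le> card Up"
  by (rule card_mono[OF finite_switches(2)]) auto

abbreviation "dns \<equiv> sorted_list_of_set Dn"
abbreviation "ups \<equiv> sorted_list_of_set Up"

lemma dn_le: "k < card Dn \<Longrightarrow> dns ! k \<le> d \<longleftrightarrow> k < card {p \<in> Dn. p \<le> d}"
  by (rule nth_sorted_le_iff[OF finite_switches(1)])

lemma up_le: "k < card Up \<Longrightarrow> ups ! k \<le> d \<longleftrightarrow> k < card {p \<in> Up. p \<le> d}"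
  by (rule nth_sorted_le_iff[OF finite_switches(2)])

lemma up_mem: "k < card Up \<Longrightarrow> ups ! k \<in> Up"
  using nth_mem[of k ups] finite_switches(2) by simp

text \<open>When \<open>f d\<close> holds, equally many switches of both kinds lie at or below d. If
  there are k + 1 of each, d is at or after entry k of \<open>ups\<close> and before entry k + 1 of
  \<open>dns\<close>; equality gives a diagonal of \<open>region_I\<close>, the rest
  \<open>region_A\<close>.\<close>

lemma high_iff:
  "f d \<longleftrightarrow> d \<in> Up \<or> d < dns ! 0 \<or> (\<exists>k<card Up. ups ! k < d \<and> d < dns ! (k + 1))"
proof
  assume fd: "f d"
  let ?n = "card {p \<in> Up. p \<le> d}"
  have n: "card {p \<in> Dn. p \<le> d} = ?n" "?n \<le> card Up" using switch_count[of d] fd count_le_card by simp_all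
  show "d \<in> Up \<or> d < dns ! 0 \<or> (\<exists>k<card Up. ups ! k < d \<and> d < dns ! (k + 1))"
  proof (cases "d \<in> Up \<or> ?n = 0")
    case True
    then show ?thesis using dn_le[of 0 d] n card_Dn by auto
  next
    case False
    then obtain k where k: "?n = Suc k" by (cases ?n) auto
    then have "ups ! k \<le> d" "\<not> dns ! (k + 1) \<le> d"
      using up_le[of k d] dn_le[of "k + 1" d] n card_Dn by auto
    moreover have "ups ! k \<noteq> d" using False up_mem[of k] k n by auto
    ultimately have "ups ! k < d \<and> d < dns ! (k + 1)" by simp
    then show ?thesis using k n by (intro disjI2 exI[of _ k]) simp
  qed
next
  assume "d \<in> Up \<or> d < dns ! 0 \<or> (\<exists>k<card Up. ups ! k < d \<and> d < dns ! (k + 1))"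
  then consider "d \<in> Up" | "d < dns ! 0" | k where "k < card Up" "ups ! k < d" "d < dns ! (k + 1)" by blast
  then show "f d"
  proof cases
    case 1
    then show ?thesis by (simp add: Up)
  next
    case 2
    then have "card {p \<in> Dn. p \<le> d} = 0" using dn_le[of 0 d] card_Dn by simp
    then show ?thesis using switch_count[of d] by (simp split: if_splits)
  next
    case 3
    then have "k < card {p \<in> Up. p \<le> d}" "\<not> k + 1 < card {p \<in> Dn. p \<le> d}"
      using up_le[of k d] dn_le[of "k + 1" d] card_Dn by auto
    then show ?thesis using switch_count[of d] by (simp split: if_splits)
  qed
qed

text \<open>The same count, taken at d - 1, where one more downward than upward switch has occurred.
  Counting at d - 1 makes the lower bound on d strict and leaves the upper bound weak; equality
  there is the case of an inner corner.\<close>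

lemma low_iff:
  "\<not> f (d - 1) \<longleftrightarrow> d \<in> Up \<or> (\<exists>k<card Up. dns ! k < d \<and> d < ups ! k) \<or> dns ! card Up < d"
proof
  assume fd: "\<not> f (d - 1)"
  let ?n = "card {p \<in> Up. p \<le> d - 1}"
  have n: "card {p \<in> Dn. p \<le> d - 1} = ?n + 1" "?n \<le> card Up"
    using switch_count[of "d - 1"] fd count_le_card[of "d - 1"] by simp_all
  have dn: "dns ! ?n < d" using dn_le[of ?n "d - 1"] n card_Dn by simp
  show "d \<in> Up \<or> (\<exists>k<card Up. dns ! k < d \<and> d < ups ! k) \<or> dns ! card Up < d"
  proof (cases "?n = card Up")
    case True
    then show ?thesis using dn by simp
  next
    case False
    then have "?n < card Up" "\<not> ups ! ?n \<le> d - 1" using n up_le[of ?n "d - 1"] by simp_all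
    then show ?thesis using dn up_mem[of ?n] by (cases "ups ! ?n = d") auto
  qed
next
  assume "d \<in> Up \<or> (\<exists>k<card Up. dns ! k < d \<and> d < ups ! k) \<or> dns ! card Up < d"
  then consider "d \<in> Up" | k where "k < card Up" "dns ! k < d" "d < ups ! k" | "dns ! card Up < d" by blast
  then show "\<not> f (d - 1)"
  proof cases
    case 1
    then show ?thesis by (simp add: Up)
  next
    case 2
    then have "k < card {p \<in> Dn. p \<le> d - 1}" "\<not> k < card {p \<in> Up. p \<le> d - 1}"
      using up_le[of k "d - 1"] dn_le[of k "d - 1"] card_Dn by auto
    then show ?thesis using switch_count[of "d - 1"] by (simp split: if_splits)
  next
    case 3
    then have "card Up < card {p \<in> Dn. p \<le> d - 1}" using dn_le[of "card Up" "d - 1"] card_Dn by auto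
    then show ?thesis using switch_count[of "d - 1"] count_le_card[of "d - 1"] by (simp split: if_splits)
  qed
qed

end

section \<open>Corners as switches of the boundary\<close>

lemma diag_compare:
  assumes "young \<nu>" "(i, j) \<in> \<nu>" "(k, l) \<notin> \<nu>" "1 \<le> k" "1 \<le> l"
  shows "i < k \<or> j < l"
  using young_down[OF assms(1,2), of k l] assms by linarith

text \<open>The clause on all contents declares the boundary horizontal before the diagram starts.
  Otherwise the first column would produce a spurious upward switch, and the alternation would not
  begin with an outer corner.\<close>

lemma outer_corner_iff_hor:
  assumes "young \<nu>"
  shows "d \<in> content ` {u. outer_corner \<nu> u} \<longleftrightarrow>
    (hor \<nu> (d - 1) \<or> (\<forall>u\<in>\<nu>. d - 1 < content u)) \<and> \<not> (hor \<nu> d \<or> (\<forall>u\<in>\<nu>. d < content u))"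
    (is "?L \<longleftrightarrow> ?R")
proof
  assume ?L
  then obtain a b where u: "(a, b) \<in> \<nu>" "(a, b + 1) \<notin> \<nu>" "(a + 1, b) \<notin> \<nu>" "d = b - a"
    by (auto simp: outer_corner_def)
  have "hor \<nu> (d - 1)" unfolding hor_def using u by (intro exI[of _ a] exI[of _ b]) simp
  moreover have "\<not> hor \<nu> d"
  proof
    assume "hor \<nu> d"
    then obtain i j where v: "(i, j) \<in> \<nu>" "(i + 1, j) \<notin> \<nu>" "j - i = d + 1" by (auto simp: hor_def)
    then show False using diag_compare[OF assms v(1) u(2)] diag_compare[OF assms u(1) v(2)]
        young_pos[OF assms v(1)] young_pos[OF assms u(1)] u(4) by linarith
  qed
  ultimately show ?R using u by fastforce
next
  assume R: ?R
  then obtain k l where kl: "(k, l) \<in> \<nu>" "l - k \<le> d" by fastforce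
  have "hor \<nu> (d - 1)"
  proof (rule ccontr)
    assume nh: "\<not> hor \<nu> (d - 1)"
    with R have all: "\<forall>u\<in>\<nu>. d - 1 < content u" by blast
    then have d: "l - k = d" using kl by fastforce
    have "(k + 1, l) \<notin> \<nu>" using all d by fastforce
    then show False using nh kl d by (auto simp: hor_def)
  qed
  then obtain i j where v: "(i, j) \<in> \<nu>" "(i + 1, j) \<notin> \<nu>" "j - i = d" by (auto simp: hor_def)
  have "(i, j + 1) \<notin> \<nu>"
  proof
    assume e: "(i, j + 1) \<in> \<nu>"
    have "(i + 1, j + 1) \<notin> \<nu>"
      using diag_compare[OF assms _ v(2), of "i + 1" "j + 1"] young_pos[OF assms v(1)] by auto
    then show False using R e v(3) unfolding hor_def by (metis add.commute add_diff_eq)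
  qed
  then have "outer_corner \<nu> (i, j)" using v by (simp add: outer_corner_def)
  then show ?L using v(3) by force
qed

lemma inner_corner_iff_hor:
  assumes "young \<nu>"
  shows "d \<in> content ` {u. inner_corner \<nu> u} \<longleftrightarrow>
    \<not> (hor \<nu> (d - 1) \<or> (\<forall>u\<in>\<nu>. d - 1 < content u)) \<and> (hor \<nu> d \<or> (\<forall>u\<in>\<nu>. d < content u))"
    (is "?L \<longleftrightarrow> ?R")
proof
  assume ?L
  then obtain a b where u: "(a, b) \<in> \<nu>" "(a, b + 1) \<in> \<nu>" "(a + 1, b) \<in> \<nu>" "(a + 1, b + 1) \<notin> \<nu>" "d = b - a"
    by (auto simp: inner_corner_def)
  have "hor \<nu> d" unfolding hor_def using u by (intro exI[of _ a] exI[of _ "b + 1"]) simp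
  moreover have "\<not> hor \<nu> (d - 1)"
  proof
    assume "hor \<nu> (d - 1)"
    then obtain i j where v: "(i, j) \<in> \<nu>" "(i + 1, j) \<notin> \<nu>" "j - i = d" by (auto simp: hor_def)
    then show False using diag_compare[OF assms v(1) u(4)] diag_compare[OF assms u(3) v(2)]
        young_pos[OF assms v(1)] young_pos[OF assms u(1)] u(5) by linarith
  qed
  moreover have "\<not> d - 1 < content (a + 1, b)" using u(5) by simp
  ultimately show ?R using u(3) by blast
next
  assume R: ?R
  then obtain k l where kl: "(k, l) \<in> \<nu>" "l - k \<le> d - 1" by fastforce
  then have "\<not> d < content (k, l)" by simp
  with R kl(1) have "hor \<nu> d" by blast
  then obtain i j where v: "(i, j) \<in> \<nu>" "(i + 1, j) \<notin> \<nu>" "j - i = d + 1" by (auto simp: hor_def)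
  have pos: "1 \<le> i" "1 \<le> j" "1 \<le> k" "1 \<le> l" using young_pos[OF assms v(1)] young_pos[OF assms kl(1)] by simp_all
  then have "j \<noteq> 1" using diag_compare[OF assms kl(1) v(2)] kl(2) v(3) by auto
  then have w: "(i, j - 1) \<in> \<nu>" using young_down[OF assms v(1), of i "j - 1"] pos by simp
  have "(i + 1, j - 1) \<in> \<nu>"
  proof (rule ccontr)
    assume "(i + 1, j - 1) \<notin> \<nu>"
    then have "hor \<nu> (d - 1)" unfolding hor_def using w v(3) by (intro exI[of _ i] exI[of _ "j - 1"]) simp
    then show False using R by blast
  qed
  then have "inner_corner \<nu> (i, j - 1)" using v w by (simp add: inner_corner_def)
  moreover have "content (i, j - 1) = d" using v(3) by simp
  ultimately show ?L by force
qed

lemma regions_hor: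
  assumes "young \<nu>" "u \<in> \<nu>"
  shows "u \<in> region_I \<nu> \<union> region_A \<nu> \<longleftrightarrow> hor \<nu> (content u)" (is ?east)
    and "u \<in> region_B \<nu> \<union> region_I \<nu> \<longleftrightarrow> \<not> hor \<nu> (content u - 1)" (is ?south)
proof -
  define f where "f d \<longleftrightarrow> hor \<nu> d \<or> (\<forall>u\<in>\<nu>. d < content u)" for d
  define Dn where "Dn = content ` {u. outer_corner \<nu> u}"
  define Up where "Up = content ` {u. inner_corner \<nu> u}"
  define lo where "lo = Min (content ` \<nu>)"
  define hi where "hi = Max (content ` \<nu>)"
  have fin: "finite (content ` \<nu>)" using young_finite[OF assms(1)] by simp
  interpret switches f lo hi Dn Up
  proof
    show "f d" if "d < lo" for d
      using that Min_le[OF fin] unfolding f_def lo_def by (meson image_eqI less_le_trans)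
    show "\<not> f d" if "hi \<le> d" for d
    proof
      assume "f d"
      moreover have le: "content v \<le> d" if "v \<in> \<nu>" for v
        using Max_ge[OF fin, of "content v"] that \<open>hi \<le> d\<close> by (simp add: hi_def)
      then have "\<not> d < content u" using assms(2) by (simp add: not_less)
      ultimately obtain i j where "(i, j) \<in> \<nu>" "j - i = d + 1" using assms(2) by (auto simp: f_def hor_def)
      then show False using le[of "(i, j)"] by simp
    qed
    show "Dn = {d. f (d - 1) \<and> \<not> f d}"
      unfolding Dn_def f_def using outer_corner_iff_hor[OF assms(1)] by blast
    show "Up = {d. \<not> f (d - 1) \<and> f d}"
      unfolding Up_def f_def using inner_corner_iff_hor[OF assms(1)] by blast
  qed
  have lists: "outer_contents \<nu> = dns" "inner_contents \<nu> = ups" "set ups = Up" "length ups = card Up"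
    using finite_switches(2) by (simp_all add: outer_contents_def inner_contents_def Dn_def Up_def)
  have "u \<in> region_I \<nu> \<union> region_A \<nu> \<longleftrightarrow> f (content u)"
    unfolding high_iff region_I_def region_A_def lists using assms(2) by blast
  also have "\<dots> \<longleftrightarrow> hor \<nu> (content u)" using assms(2) by (auto simp: f_def)
  finally show ?east .
  have "u \<in> region_B \<nu> \<union> region_I \<nu> \<longleftrightarrow> \<not> f (content u - 1)"
    unfolding low_iff region_I_def region_B_def lists using assms(2) by blast
  also have "\<dots> \<longleftrightarrow> \<not> hor \<nu> (content u - 1)"
  proof -
    \<comment> \<open>On the first diagonal the artificial clause agrees with \<open>hor\<close>: a
      southern neighbour of u would have smaller content, so u is the bottom cell of its
      column.\<close>
    have "hor \<nu> (content u - 1)" if all: "\<forall>v\<in>\<nu>. content u - 1 < content v"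
    proof -
      obtain i j where u: "u = (i, j)" by fastforce
      have "\<not> content u - 1 < content (i + 1, j)" using u by simp
      then have "(i + 1, j) \<notin> \<nu>" using all by blast
      then show ?thesis using assms(2) u by (auto simp: hor_def)
    qed
    then show ?thesis by (auto simp: f_def)
  qed
  finally show ?south .
qed

subsection \<open>Reverse plane partitions\<close>

text \<open>As rewrite rules the commutations put vertical steps outermost, which gives composed
  steps a normal form.\<close>

lemma step_cancel [simp]:
  "west (east u) = u" "east (west u) = u" "north (south u) = u" "south (north u) = u"
  "west (south u) = south (west u)" "west (north u) = north (west u)"
  "east (south u) = south (east u)" "east (north u) = north (east u)"
  by (cases u; simp)+

lemma step_eq_iff [simp]:
  "west u = west v \<longleftrightarrow> u = v" "east u = east v \<longleftrightarrow> u = v"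
  "north u = north v \<longleftrightarrow> u = v" "south u = south v \<longleftrightarrow> u = v"
  by (cases u; cases v; simp)+

lemma south_ne_west [simp]: "south u \<noteq> west u" "west u \<noteq> south u"
  by (cases u; simp)+

lemma mem_if_south:
  assumes "young \<nu>" "south u \<in> \<nu>" "1 \<le> fst u"
  shows "u \<in> \<nu>"
proof -
  obtain i j where u: "u = (i, j)" by fastforce
  then show ?thesis using assms young_down[OF assms(1), of "i + 1" j i j] young_pos[OF assms(1), of "i + 1" j]
    by simp
qed

lemma mem_if_east:
  assumes "young \<nu>" "east u \<in> \<nu>" "1 \<le> snd u"
  shows "u \<in> \<nu>"
proof -
  obtain i j where u: "u = (i, j)" by fastforce
  then show ?thesis using assms young_down[OF assms(1), of i "j + 1" i j] young_pos[OF assms(1), of i "j + 1"]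
    by simp
qed

text \<open>Agrees with \<open>val\<close> except on the cells where \<open>val\<close> is infinite.\<close>

definition val0 :: "cell set \<Rightarrow> (cell \<Rightarrow> nat) \<Rightarrow> cell \<Rightarrow> nat" where
  "val0 \<nu> \<pi> u = (if u \<in> \<nu> then \<pi> u else 0)"

lemma val0_mem [simp]: "u \<in> \<nu> \<Longrightarrow> val0 \<nu> \<pi> u = \<pi> u"
  by (simp add: val0_def)

lemma val_mem:
  assumes "young \<nu>" "u \<in> \<nu>"
  shows "val \<nu> \<pi> u = enat (\<pi> u)"
  using young_pos[OF assms(1), of "fst u" "snd u"] assms(2) by (simp add: val_def)

text \<open>Leaving the diagram northwards from a cell crosses the axis, where the convention is 0
  and not infinity; hence natural numbers suffice.\<close>

lemma val_north:
  assumes "young \<nu>" "u \<in> \<nu>"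
  shows "val \<nu> \<pi> (north u) = enat (val0 \<nu> \<pi> (north u))"
proof (cases "1 \<le> fst (north u)")
  case True
  then have "north u \<in> \<nu>" using mem_if_south[OF assms(1), of "north u"] assms(2) by simp
  then show ?thesis using val_mem[OF assms(1)] by simp
next
  case False
  then have "north u \<notin> \<nu>" using young_pos[OF assms(1), of "fst (north u)" "snd (north u)"] by auto
  then show ?thesis using False by (simp add: val_def val0_def zero_enat_def)
qed

lemma val_west:
  assumes "young \<nu>" "u \<in> \<nu>"
  shows "val \<nu> \<pi> (west u) = enat (val0 \<nu> \<pi> (west u))"
proof (cases "1 \<le> snd (west u)")
  case True
  then have "west u \<in> \<nu>" using mem_if_east[OF assms(1), of "west u"] assms(2) by simp
  then show ?thesis using val_mem[OF assms(1)] by simp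
next
  case False
  then have "west u \<notin> \<nu>" using young_pos[OF assms(1), of "fst (west u)" "snd (west u)"] by auto
  then show ?thesis using False by (simp add: val_def val0_def zero_enat_def)
qed

lemma val_out:
  assumes "young \<nu>" "u \<in> \<nu>"
  shows "east u \<notin> \<nu> \<Longrightarrow> val \<nu> \<pi> (east u) = \<infinity>" "south u \<notin> \<nu> \<Longrightarrow> val \<nu> \<pi> (south u) = \<infinity>"
  using young_pos[OF assms(1), of "fst u" "snd u"] assms(2) by (cases u; auto simp: val_def)+

lemma RPP_iff:
  assumes "young \<nu>"
  shows "\<pi> \<in> RPP \<nu> \<longleftrightarrow> \<pi> \<in> Tab \<nu> \<and>
    (\<forall>u\<in>\<nu>. (east u \<in> \<nu> \<longrightarrow> \<pi> u \<le> \<pi> (east u)) \<and> (south u \<in> \<nu> \<longrightarrow> \<pi> u \<le> \<pi> (south u)))"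
proof -
  have "val \<nu> \<pi> u \<le> val \<nu> \<pi> (east u) \<longleftrightarrow> (east u \<in> \<nu> \<longrightarrow> \<pi> u \<le> \<pi> (east u))"
    and "val \<nu> \<pi> u \<le> val \<nu> \<pi> (south u) \<longleftrightarrow> (south u \<in> \<nu> \<longrightarrow> \<pi> u \<le> \<pi> (south u))"
    if "u \<in> \<nu>" for u
    using val_mem[OF assms] val_out[OF assms that, of \<pi>] that
    by (cases "east u \<in> \<nu>"; cases "south u \<in> \<nu>"; simp)+
  then show ?thesis unfolding RPP_def by blast
qed

lemma RPP_east: "young \<nu> \<Longrightarrow> \<pi> \<in> RPP \<nu> \<Longrightarrow> u \<in> \<nu> \<Longrightarrow> east u \<in> \<nu> \<Longrightarrow> \<pi> u \<le> \<pi> (east u)"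
  by (simp add: RPP_iff)

lemma RPP_south: "young \<nu> \<Longrightarrow> \<pi> \<in> RPP \<nu> \<Longrightarrow> u \<in> \<nu> \<Longrightarrow> south u \<in> \<nu> \<Longrightarrow> \<pi> u \<le> \<pi> (south u)"
  by (simp add: RPP_iff)

lemma RPP_north: "young \<nu> \<Longrightarrow> \<pi> \<in> RPP \<nu> \<Longrightarrow> u \<in> \<nu> \<Longrightarrow> val0 \<nu> \<pi> (north u) \<le> \<pi> u"
  using RPP_south[of \<nu> \<pi> "north u"] by (simp add: val0_def)

lemma RPP_west: "young \<nu> \<Longrightarrow> \<pi> \<in> RPP \<nu> \<Longrightarrow> u \<in> \<nu> \<Longrightarrow> val0 \<nu> \<pi> (west u) \<le> \<pi> u"
  using RPP_east[of \<nu> \<pi> "west u"] by (simp add: val0_def)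

lemma RPP_Tab: "\<pi> \<in> RPP \<nu> \<Longrightarrow> \<pi> \<in> Tab \<nu>"
  by (simp add: RPP_def)

lemma TabD: "t \<in> Tab \<nu> \<Longrightarrow> u \<notin> \<nu> \<Longrightarrow> t u = undefined"
  unfolding Tab_def by (rule PiE_arb)

lemma Tab_eqI:
  assumes "s \<in> Tab \<nu>" "t \<in> Tab \<nu>" "\<And>u. u \<in> \<nu> \<Longrightarrow> s u = t u"
  shows "s = t"
  using assms unfolding Tab_def by (intro PiE_ext)

text \<open>Exempts the tail of an insertion path, which has no eastern neighbour in \<nu>, from the
  east condition of \<open>compatible\<close>.\<close>

lemma not_hor_row_end:
  assumes "young \<nu>" "(i, j) \<in> \<nu>" "(i, j + 1) \<notin> \<nu>"
  shows "\<not> hor \<nu> (j - i)"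
proof
  assume "hor \<nu> (j - i)"
  then obtain k l where v: "(k, l) \<in> \<nu>" "(k + 1, l) \<notin> \<nu>" "l - k = j - i + 1" by (auto simp: hor_def)
  then show False using diag_compare[OF assms(1) v(1) assms(3)] diag_compare[OF assms(1,2) v(2)]
      young_pos[OF assms(1) v(1)] young_pos[OF assms(1,2)] by linarith
qed

lemma south_mem:
  assumes "u \<in> \<nu>" "\<not> hor \<nu> (content u - 1)"
  shows "south u \<in> \<nu>"
proof (rule ccontr)
  obtain i j where u: "u = (i, j)" by fastforce
  assume "south u \<notin> \<nu>"
  then have "hor \<nu> (content u - 1)" unfolding hor_def u using assms(1) u
    by (intro exI[of _ i] exI[of _ j]) simp
  then show False using assms(2) by simp
qed

subsection \<open>Insertion paths\<close>

text \<open>One step of \<open>walk\<close>, with the regions replaced by the boundary and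
  \<open>val\<close> by plain entries. When the boundary test passes, \<open>south u\<close> is a
  cell by \<open>south_mem\<close>.\<close>

definition sw_step :: "cell set \<Rightarrow> (cell \<Rightarrow> nat) \<Rightarrow> cell \<Rightarrow> cell" where
  "sw_step \<nu> \<pi> u = (if \<not> hor \<nu> (content u - 1) \<and> \<pi> u = \<pi> (south u) then south u else west u)"

lemma walk_Suc:
  assumes "young \<nu>" "u \<in> \<nu>"
  shows "walk \<nu> \<pi> (Suc n) u = u # walk \<nu> \<pi> n (sw_step \<nu> \<pi> u)"
proof -
  have "val \<nu> \<pi> u = val \<nu> \<pi> (south u) \<longleftrightarrow> \<pi> u = \<pi> (south u)" if "\<not> hor \<nu> (content u - 1)"
    using val_mem[OF assms(1)] assms(2) south_mem[OF assms(2) that] by simp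
  then show ?thesis using regions_hor(2)[OF assms] by (auto simp: sw_step_def)
qed

text \<open>Adding a path depends only on its set of cells, and this form accepts images of the
  content-indexed functions used below.\<close>

definition inc :: "cell set \<Rightarrow> (cell \<Rightarrow> nat) \<Rightarrow> cell set \<Rightarrow> cell \<Rightarrow> nat" where
  "inc \<nu> \<pi> S = (\<lambda>u\<in>\<nu>. if u \<in> S then \<pi> u + 1 else \<pi> u)"

text \<open>For \<open>d = j - col_len \<nu> j\<close> this says that the partitions on both sides of the bottom edge of
  column \<open>j\<close> agree.\<close>

definition edge_eq :: "cell set \<Rightarrow> (cell \<Rightarrow> nat) \<Rightarrow> int \<Rightarrow> bool" where
  "edge_eq \<nu> \<pi> d \<longleftrightarrow> (\<forall>v\<in>\<nu>. content v = d \<longrightarrow> val0 \<nu> \<pi> (west v) = \<pi> v)"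

text \<open>The insertion path as a function from contents in \<open>{d1..d0}\<close> to cells. The last conjunct is the
  second invariant: agreement with the diagonal \<open>d1 - 1\<close> below the head of the path.\<close>

definition insertion_fun :: "cell set \<Rightarrow> (cell \<Rightarrow> nat) \<Rightarrow> int \<Rightarrow> int \<Rightarrow> (int \<Rightarrow> cell) \<Rightarrow> bool" where
  "insertion_fun \<nu> \<pi> d1 d0 g \<longleftrightarrow>
     (\<forall>d. d1 < d \<longrightarrow> d \<le> d0 \<longrightarrow> g (d - 1) = sw_step \<nu> \<pi> (g d)) \<and>
     (\<forall>d. d1 \<le> d \<longrightarrow> d \<le> d0 \<longrightarrow> g d \<in> \<nu> \<and> content (g d) = d) \<and>
     (\<forall>d. d1 \<le> d \<longrightarrow> d < d0 \<longrightarrow> hor \<nu> d \<longrightarrow> \<pi> (g d) = \<pi> (g (d + 1))) \<and>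
     (\<forall>v\<in>\<nu>. content v = d1 \<longrightarrow> fst (g d1) < fst v \<longrightarrow> val0 \<nu> \<pi> (west v) = \<pi> v)"

text \<open>Every step lowers the content by one, so the walk lists g from the top of the interval
  of contents downwards.\<close>

lemma walk_fun:
  assumes "young \<nu>"
  shows "\<lbrakk>\<forall>d. d0 - int n < d \<longrightarrow> d \<le> d0 \<longrightarrow> g (d - 1) = sw_step \<nu> \<pi> (g d);
     \<forall>d. d0 - int n \<le> d \<longrightarrow> d \<le> d0 \<longrightarrow> g d \<in> \<nu>\<rbrakk>
    \<Longrightarrow> walk \<nu> \<pi> n (g d0) = map g (rev [d0 - int n..d0])"
proof (induction n arbitrary: d0)
  case 0
  then show ?case by simp
next
  case (Suc n)
  have "walk \<nu> \<pi> (Suc n) (g d0) = g d0 # walk \<nu> \<pi> n (g (d0 - 1))"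
    using walk_Suc[OF assms] Suc.prems by simp
  also have "walk \<nu> \<pi> n (g (d0 - 1)) = map g (rev [d0 - 1 - int n..d0 - 1])"
    by (rule Suc.IH) (use Suc.prems in auto)
  also have "[d0 - int (Suc n)..d0] = [d0 - 1 - int n..d0 - 1] @ [d0]"
    using upto_rec2[of "d0 - int (Suc n)" d0] by (simp add: algebra_simps)
  then have "g d0 # map g (rev [d0 - 1 - int n..d0 - 1]) = map g (rev [d0 - int (Suc n)..d0])" by simp
  finally show ?case .
qed

text \<open>The path traced by \<open>walk\<close> is itself a witness for \<open>inserts\<close>,
  so the conditional in \<open>insert_hook\<close> selects the actual insertion.\<close>

lemma insert_hook_fun:
  assumes young: "young \<nu>" and mem: "(i, j) \<in> \<nu>"
    and g: "insertion_fun \<nu> \<pi> (j - col_len \<nu> j) (row_len \<nu> i - i) g"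
    and start: "g (row_len \<nu> i - i) = (i, row_len \<nu> i)"
    and rpp: "inc \<nu> \<pi> (g ` {j - col_len \<nu> j..row_len \<nu> i - i}) \<in> RPP \<nu>"
  shows "insert_hook \<nu> (hook_at \<nu> (i, j)) \<pi> = inc \<nu> \<pi> (g ` {j - col_len \<nu> j..row_len \<nu> i - i})"
proof -
  define d0 where "d0 = row_len \<nu> i - i"
  define d1 where "d1 = j - col_len \<nu> j"
  define n where "n = path_len (hook_at \<nu> (i, j))"
  have n: "d1 = d0 - int n" unfolding n_def d0_def d1_def path_len_hook_at[OF young mem] by simp
  note start = start[folded d0_def]
  have steps: "\<And>d. d1 < d \<Longrightarrow> d \<le> d0 \<Longrightarrow> g (d - 1) = sw_step \<nu> \<pi> (g d)"
    and mems: "\<And>d. d1 \<le> d \<Longrightarrow> d \<le> d0 \<Longrightarrow> g d \<in> \<nu>"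
    and cont: "\<And>d. d1 \<le> d \<Longrightarrow> d \<le> d0 \<Longrightarrow> content (g d) = d"
    and eqs: "\<And>d. d1 \<le> d \<Longrightarrow> d < d0 \<Longrightarrow> hor \<nu> d \<Longrightarrow> \<pi> (g d) = \<pi> (g (d + 1))"
    using g unfolding insertion_fun_def d0_def d1_def by simp_all
  define P where "P = insertion_path \<nu> (hook_at \<nu> (i, j)) \<pi>"
  have "P = walk \<nu> \<pi> n (g d0)"
    by (simp add: P_def insertion_path_def n_def hook_at_rim_hook(3)[OF young mem] start)
  also have "\<dots> = map g (rev [d1..d0])"
    unfolding n by (rule walk_fun[OF young]) (use steps mems n in simp_all)
  finally have P: "P = map g (rev [d1..d0])" .
  have "d1 \<le> d0" using n by simp
  then have len: "length P = Suc n" using n by (simp add: P)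
  have nth: "P ! k = g (d0 - int k)" if "k \<le> n" for k
  proof -
    have "rev [d1..d0] ! k = [d1..d0] ! (n - k)" using n that by (subst rev_nth) auto
    also have "\<dots> = d0 - int k" using n that by (subst nth_upto) auto
    finally show ?thesis using n that by (simp add: P)
  qed
  have set: "set P = g ` {d1..d0}" by (simp add: P)
  have add: "add_path \<nu> \<pi> P = inc \<nu> \<pi> (g ` {d1..d0})" by (simp add: add_path_def inc_def set)
  have "sw_path \<nu> P" unfolding sw_path_def
  proof (intro conjI allI impI)
    show "P \<noteq> []" using len by auto
    show "set P \<subseteq> \<nu>" using mems by (auto simp: set)
    show "P ! Suc k \<in> {south (P ! k), west (P ! k)}" if "Suc k < length P" for k
    proof -
      have "P ! Suc k = sw_step \<nu> \<pi> (P ! k)"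
        using that len n nth[of "Suc k"] nth[of k] steps[of "d0 - int k"] by (simp add: algebra_simps)
      then show ?thesis by (simp add: sw_step_def)
    qed
  qed
  moreover have "hd P = last (hook_at \<nu> (i, j))"
    using nth[of 0] len start hook_at_rim_hook(3)[OF young mem] by (cases P) simp_all
  moreover have "path_len P = path_len (hook_at \<nu> (i, j))" using len by (simp add: path_len_def[of P] n_def)
  moreover have "compatible \<nu> P \<pi>" unfolding compatible_def
  proof (intro conjI ballI allI impI)
    fix u assume u: "u \<in> set P \<inter> (region_I \<nu> \<union> region_A \<nu>)"
    then obtain d where d: "u = g d" "d1 \<le> d" "d \<le> d0" using set by auto
    then have hor: "hor \<nu> d" using u regions_hor(1)[OF young mems] cont by simp
    have "(i, row_len \<nu> i) \<in> \<nu>" "(i, row_len \<nu> i + 1) \<notin> \<nu>"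
      using mems[of d0] start n mem_row[OF young] by simp_all
    \<comment> \<open>The path starts at a row end, so the cell u under consideration is not the
      first one and was reached by a step west.\<close>
    then have "\<not> hor \<nu> d0" unfolding d0_def by (rule not_hor_row_end[OF young])
    then have less: "d < d0" using hor d by (cases "d = d0") auto
    then have "g d = west (g (d + 1))"
      using steps[of "d + 1"] d cont[of "d + 1"] hor by (simp add: sw_step_def)
    then have e: "east u = g (d + 1)" by (simp add: d)
    then show "east u \<in> set P" using d less set by simp
    show "val \<nu> \<pi> u = val \<nu> \<pi> (east u)"
      using e eqs[OF d(2) less hor] val_mem[OF young] mems d less by simp
  next
    fix u assume u: "u \<in> set P \<and> south u \<in> set P"
    then obtain d e where d: "u = g d" "d1 \<le> d" "d \<le> d0" "south u = g e" "d1 \<le> e" "e \<le> d0" using set by auto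
    \<comment> \<open>Vertically adjacent cells of the path are consecutive on it, and a step south
      is taken only between equal entries.\<close>
    then have "e = d - 1" using cont[of d] cont[of e] content_steps(3)[of u] by simp
    then have "south u = sw_step \<nu> \<pi> u" using steps[of d] d by simp
    then have "\<pi> u = \<pi> (south u)" by (auto simp: sw_step_def split: if_splits)
    moreover have "u \<in> \<nu>" "south u \<in> \<nu>" using mems d by simp_all
    ultimately show "val \<nu> \<pi> u = val \<nu> \<pi> (south u)" using val_mem[OF young] by simp
  qed
  ultimately have "inserts \<nu> (hook_at \<nu> (i, j)) \<pi>"
    unfolding inserts_def using rpp add by (intro exI[of _ P]) (simp add: d0_def d1_def)
  then show ?thesis using add by (simp add: insert_hook_def P_def d0_def d1_def)
qed

text \<open>A path meets each diagonal of its interval once, so membership is a question about a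
  single value of g.\<close>

lemma fun_image_iff:
  assumes "\<And>d. d1 \<le> d \<Longrightarrow> d \<le> d0 \<Longrightarrow> content (g d) = d"
  shows "v \<in> g ` {d1..d0} \<longleftrightarrow> d1 \<le> content v \<and> content v \<le> d0 \<and> g (content v) = v"
  using assms by (auto intro: rev_image_eqI)

subsection \<open>Removing a corner\<close>

locale corner =
  fixes \<nu> :: "cell set" and a b :: int
  assumes young: "young \<nu>" and corner_mem: "(a, b) \<in> \<nu>"
    and corner_east: "(a, b + 1) \<notin> \<nu>" and corner_south: "(a + 1, b) \<notin> \<nu>"
begin

abbreviation c :: int where "c \<equiv> b - a"
abbreviation x :: cell where "x \<equiv> (a, b)"
abbreviation \<mu> :: "cell set" where "\<mu> \<equiv> \<nu> - {(a, b)}"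

lemma outer: "outer_corner \<nu> x"
  using corner_mem corner_east corner_south by (simp add: outer_corner_def)

lemma young_mu: "young \<mu>"
  by (rule young_remove_corner[OF young outer])

lemma a_pos: "1 \<le> a" and b_pos: "1 \<le> b"
  using young_pos[OF young corner_mem] by simp_all

text \<open>These cells lie strictly north-west of the corner, so all the values entering their
  toggle are finite.\<close>

lemma mu_diag:
  assumes "v \<in> \<mu>" "content v = c"
  shows "east v \<in> \<mu>" "south v \<in> \<mu>"
proof -
  obtain i j where v: "v = (i, j)" by fastforce
  have vn: "(i, j) \<in> \<nu>" using assms v by simp
  note pos = young_pos[OF young vn]
  have "i \<le> a" using diag_compare[OF young vn corner_south] a_pos b_pos assms(2) v by auto
  moreover have "i \<noteq> a" using assms v by auto
  ultimately have "i + 1 \<le> a" "j + 1 \<le> b" using assms(2) v by auto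
  then show "east v \<in> \<mu>" "south v \<in> \<mu>"
    using young_down[OF young corner_mem, of i "j + 1"] young_down[OF young corner_mem, of "i + 1" j] pos v
      assms(2) by auto
qed

lemma upper_diag:
  assumes "v \<in> \<nu>" "content v = c + 1"
  shows "south v \<in> \<nu>" "fst v < a" "v \<in> \<mu>"
proof -
  obtain i j where v: "v = (i, j)" by fastforce
  have vn: "(i, j) \<in> \<nu>" using assms v by simp
  note pos = young_pos[OF young vn]
  have "i < a" using diag_compare[OF young vn corner_east] a_pos b_pos assms(2) v by auto
  then have "i + 1 \<le> a" "j \<le> b" using assms(2) v by auto
  then show "south v \<in> \<nu>" "fst v < a" "v \<in> \<mu>"
    using young_down[OF young corner_mem, of "i + 1" j] pos v assms by auto
qed

lemma mu_iff: "content v \<noteq> c \<Longrightarrow> v \<in> \<mu> \<longleftrightarrow> v \<in> \<nu>"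
  by auto

text \<open>Read from the south-west, the boundary of \<nu> turns from horizontal to vertical at
  diagonal c. Removing the corner exchanges these two steps; this lemma and the next ones record the
  exchange and that all other steps stay.\<close>

lemma hor_low: "hor \<nu> (c - 1)"
  unfolding hor_def using corner_mem corner_south by (intro exI[of _ a] exI[of _ b]) simp

lemma not_hor_corner: "\<not> hor \<nu> c"
  by (rule not_hor_row_end[OF young corner_mem corner_east])

lemma not_hor_low_mu: "\<not> hor \<mu> (c - 1)"
proof
  assume "hor \<mu> (c - 1)"
  then obtain i j where "(i, j) \<in> \<mu>" "(i + 1, j) \<notin> \<mu>" "j - i = c - 1 + 1" unfolding hor_def by blast
  then show False using mu_diag(2)[of "(i, j)"] by simp
qed

text \<open>The cell v ensures that a is at least 2; for a = 1 the corner is the only cell of its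
  column, and \<mu> has no bottom edge there.\<close>

lemma hor_mu:
  assumes "v \<in> \<nu>" "content v = c + 1"
  shows "hor \<mu> c"
proof -
  have "1 \<le> fst v" using assms(1) young_pos[OF young, of "fst v" "snd v"] by simp
  then have "1 \<le> a - 1" using upper_diag(2)[OF assms] by simp
  then have "(a - 1, b) \<in> \<mu>" using young_down[OF young corner_mem, of "a - 1" b] b_pos by simp
  then show ?thesis unfolding hor_def by (intro exI[of _ "a - 1"] exI[of _ b]) simp
qed

lemma hor_mu_iff:
  assumes "d \<noteq> c" "d \<noteq> c - 1"
  shows "hor \<mu> d \<longleftrightarrow> hor \<nu> d"
proof
  assume "hor \<mu> d"
  then obtain i j where v: "(i, j) \<in> \<mu>" "(i + 1, j) \<notin> \<mu>" "j - i = d + 1" unfolding hor_def by blast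
  then have "(i + 1, j) \<noteq> x" using assms(1) by auto
  then show "hor \<nu> d" unfolding hor_def using v by (intro exI[of _ i] exI[of _ j]) simp
next
  assume "hor \<nu> d"
  then obtain i j where v: "(i, j) \<in> \<nu>" "(i + 1, j) \<notin> \<nu>" "j - i = d + 1" by (auto simp: hor_def)
  then have "(i, j) \<noteq> x" using assms(2) by auto
  then show "hor \<mu> d" unfolding hor_def using v by (intro exI[of _ i] exI[of _ j]) simp
qed

lemma row_len_mu: "i \<noteq> a \<Longrightarrow> row_len \<mu> i = row_len \<nu> i"
  by (simp add: row_len_def)

lemma col_len_mu: "j \<noteq> b \<Longrightarrow> col_len \<mu> j = col_len \<nu> j"
  by (simp add: col_len_def)

text \<open>Consequently paths for row a start at diagonal c in \<nu> but at c - 1 in \<mu>, and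
  paths for column b end at c in \<nu> but at c + 1 in \<mu>.\<close>

lemma row_len_corner: "row_len \<nu> a = b" "row_len \<mu> a = b - 1"
proof -
  show "row_len \<nu> a = b"
    using corner_mem corner_east by (simp add: mem_row[OF young])
  have "(a, b - 1) \<in> \<mu>" if "b \<noteq> 1"
    using young_down[OF young corner_mem, of a "b - 1"] a_pos b_pos that by simp
  then have "b \<noteq> 1 \<longrightarrow> b - 1 \<le> row_len \<mu> a" unfolding mem_row[OF young_mu] by simp
  moreover have "x \<notin> \<mu>" by simp
  then have "\<not> b \<le> row_len \<mu> a" unfolding mem_row[OF young_mu] using b_pos by simp
  moreover have "0 \<le> row_len \<mu> a" by (simp add: row_len_def)
  ultimately show "row_len \<mu> a = b - 1" by linarith
qed

lemma col_len_corner: "col_len \<nu> b = a" "col_len \<mu> b = a - 1"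
proof -
  show "col_len \<nu> b = a"
    using corner_mem corner_south by (simp add: mem_col[OF young])
  have "(a - 1, b) \<in> \<mu>" if "a \<noteq> 1"
    using young_down[OF young corner_mem, of "a - 1" b] a_pos b_pos that by simp
  then have "a \<noteq> 1 \<longrightarrow> a - 1 \<le> col_len \<mu> b" unfolding mem_col[OF young_mu] by simp
  moreover have "x \<notin> \<mu>" by simp
  then have "\<not> a \<le> col_len \<mu> b" unfolding mem_col[OF young_mu] using a_pos by simp
  moreover have "0 \<le> col_len \<mu> b" by (simp add: col_len_def)
  ultimately show "col_len \<mu> b = a - 1" by linarith
qed

section \<open>The toggle on the corner diagonal and its inverse\<close>

definition nw_max :: "(cell \<Rightarrow> nat) \<Rightarrow> cell \<Rightarrow> nat" where
  "nw_max \<pi> v = max (val0 \<nu> \<pi> (north v)) (val0 \<nu> \<pi> (west v))"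

text \<open>The piecewise-linear toggle: the entry is reflected in the interval which its four
  neighbours leave to it. In a reverse plane partition it lies in that interval, so the subtraction
  is exact.\<close>

definition toggle :: "(cell \<Rightarrow> nat) \<Rightarrow> cell \<Rightarrow> nat" where
  "toggle \<pi> v = nw_max \<pi> v + min (\<pi> (east v)) (\<pi> (south v)) - \<pi> v"

text \<open>The inverse of \<open>zeta\<close>, given the excess \<open>m\<close> at the corner.\<close>

definition unzeta :: "(cell \<Rightarrow> nat) \<Rightarrow> nat \<Rightarrow> cell \<Rightarrow> nat" where
  "unzeta \<kappa> m = (\<lambda>v\<in>\<nu>. if v = x then nw_max \<kappa> x + m
     else if content v = c then toggle \<kappa> v else \<kappa> v)"

lemma val0_mu: "content v \<noteq> c \<Longrightarrow> val0 \<mu> \<kappa> v = val0 \<nu> \<kappa> v"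
  by (auto simp: val0_def)

text \<open>The neighbours of diagonal c lie off it. So \<open>nw_max\<close>, though defined
  through \<nu>, serves fillings of \<mu> as well and is not affected by toggling.\<close>

lemma nw_max_cong:
  assumes "content v = c" "\<And>w. content w \<noteq> c \<Longrightarrow> w \<in> \<nu> \<Longrightarrow> \<pi> w = \<rho> w"
  shows "nw_max \<pi> v = nw_max \<rho> v"
  unfolding nw_max_def val0_def using assms by simp

lemma toggle_bounds:
  assumes "\<pi> \<in> RPP \<nu> \<or> \<pi> \<in> RPP \<mu>" "v \<in> \<mu>" "content v = c"
  shows "nw_max \<pi> v \<le> \<pi> v" "\<pi> v \<le> \<pi> (east v)" "\<pi> v \<le> \<pi> (south v)"
    "nw_max \<pi> v \<le> toggle \<pi> v" "toggle \<pi> v \<le> \<pi> (east v)" "toggle \<pi> v \<le> \<pi> (south v)"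
    "nw_max \<pi> v + min (\<pi> (east v)) (\<pi> (south v)) - toggle \<pi> v = \<pi> v"
proof -
  note d = mu_diag[OF assms(2,3)]
  show 1: "nw_max \<pi> v \<le> \<pi> v" "\<pi> v \<le> \<pi> (east v)" "\<pi> v \<le> \<pi> (south v)"
    using assms(1)
  proof (atomize (full), elim disjE, goal_cases)
    case 1
    then show ?case using RPP_north[OF young 1] RPP_west[OF young 1] RPP_east[OF young 1] RPP_south[OF young 1]
        d assms(2) by (simp add: nw_max_def)
  next
    case 2
    then show ?case using RPP_north[OF young_mu 2, of v] RPP_west[OF young_mu 2, of v]
        RPP_east[OF young_mu 2, of v] RPP_south[OF young_mu 2, of v]
        d assms(2,3) by (simp add: nw_max_def val0_mu)
  qed
  then show "nw_max \<pi> v \<le> toggle \<pi> v" "toggle \<pi> v \<le> \<pi> (east v)" "toggle \<pi> v \<le> \<pi> (south v)"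
    "nw_max \<pi> v + min (\<pi> (east v)) (\<pi> (south v)) - toggle \<pi> v = \<pi> v"
    unfolding toggle_def by linarith+
qed

lemma unzeta_off: "\<kappa> \<in> Tab \<mu> \<Longrightarrow> content v \<noteq> c \<Longrightarrow> unzeta \<kappa> m v = \<kappa> v"
  using TabD[of \<kappa> \<mu> v] by (auto simp: unzeta_def)

lemma unzeta_corner: "unzeta \<kappa> m x = nw_max \<kappa> x + m"
  using corner_mem by (simp add: unzeta_def)

lemma unzeta_diag: "v \<in> \<mu> \<Longrightarrow> content v = c \<Longrightarrow> unzeta \<kappa> m v = toggle \<kappa> v"
  by (simp add: unzeta_def)

lemma unzeta_Tab: "unzeta \<kappa> m \<in> Tab \<nu>"
  by (simp add: unzeta_def Tab_def)

text \<open>Adjacent cells have contents differing by one, so each inequality involves at most one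
  cell of diagonal c and follows there from the toggle bounds or, at x, from the excess being a
  natural number.\<close>

lemma unzeta_RPP:
  assumes "\<kappa> \<in> RPP \<mu>"
  shows "unzeta \<kappa> m \<in> RPP \<nu>"
proof -
  let ?\<pi> = "unzeta \<kappa> m"
  note off = unzeta_off[OF RPP_Tab[OF assms], of _ m]
  have low: "nw_max \<kappa> v \<le> ?\<pi> v" if "v \<in> \<nu>" "content v = c" for v
    using toggle_bounds(4)[OF disjI2[OF assms], of v] that
    by (cases "v = x") (simp_all add: unzeta_corner unzeta_diag)
  have "?\<pi> v \<le> ?\<pi> w" if v: "v \<in> \<nu>" and w: "w \<in> \<nu>" "w = east v \<or> w = south v" for v w
  proof -
    consider (1) "content v = c" | (2) "content w = c" | (3) "content v \<noteq> c" "content w \<noteq> c" by blast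
    then show ?thesis
    proof cases
      case 1
      then have "v \<noteq> x" using w corner_east corner_south by auto
      then show ?thesis using toggle_bounds(5,6)[OF disjI2[OF assms], of v] 1 v w off[of w]
        by (auto simp: unzeta_diag)
    next
      case 2
      then have "content v \<noteq> c" "v = west w \<or> v = north w" using w by auto
      then have "?\<pi> v = \<kappa> v" "\<kappa> v \<le> nw_max \<kappa> w" using off v by (auto simp: nw_max_def)
      then show ?thesis using low[OF w(1) 2] by simp
    next
      case 3
      then have "v \<in> \<mu>" "w \<in> \<mu>" using v w(1) by auto
      then show ?thesis using off[OF 3(1)] off[OF 3(2)] w(2)
          RPP_east[OF young_mu assms, of v] RPP_south[OF young_mu assms, of v] by auto
    qed
  qed
  then show ?thesis unfolding RPP_iff[OF young] using unzeta_Tab by blast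
qed

lemma zeta_eq:
  assumes "\<pi> \<in> RPP \<nu>"
  shows "zeta \<nu> x \<pi> = (\<lambda>v\<in>\<mu>. if content v = c then toggle \<pi> v else \<pi> v)"
proof -
  have "the_enat (max (val \<nu> \<pi> (north u)) (val \<nu> \<pi> (west u))
      + min (val \<nu> \<pi> (east u)) (val \<nu> \<pi> (south u)) - val \<nu> \<pi> u) = toggle \<pi> u"
    if "u \<in> \<mu>" "content u = c" for u
  proof -
    have u: "u \<in> \<nu>" "east u \<in> \<nu>" "south u \<in> \<nu>" using mu_diag[OF that] that by simp_all
    show ?thesis
      unfolding val_north[OF young u(1)] val_west[OF young u(1)] val_mem[OF young u(1)]
        val_mem[OF young u(2)] val_mem[OF young u(3)] toggle_def nw_max_def
      by (simp only: max_enat_simps min_enat_simps plus_enat_simps idiff_enat_enat the_enat.simps)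
  qed
  then show ?thesis unfolding zeta_def by (intro restrict_ext) simp
qed

lemma corner_value:
  assumes "\<pi> \<in> RPP \<nu>"
  shows "the_enat (val \<nu> \<pi> x - max (val \<nu> \<pi> (north x)) (val \<nu> \<pi> (west x))) = \<pi> x - nw_max \<pi> x"
  unfolding val_north[OF young corner_mem] val_west[OF young corner_mem] val_mem[OF young corner_mem] nw_max_def
  by (simp only: max_enat_simps idiff_enat_enat the_enat.simps)

lemma unzeta_off_nw_max:
  assumes "\<kappa> \<in> RPP \<mu>" "content v = c"
  shows "nw_max (unzeta \<kappa> m) v = nw_max \<kappa> v"
  by (rule nw_max_cong[OF assms(2)]) (simp add: unzeta_off[OF RPP_Tab[OF assms(1)]])

text \<open>Both toggles reflect in the same interval, because its bounds come from cells off
  diagonal c.\<close>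

lemma zeta_unzeta:
  assumes "\<kappa> \<in> RPP \<mu>"
  shows "zeta \<nu> x (unzeta \<kappa> m) = \<kappa>"
proof -
  note off = unzeta_off[OF RPP_Tab[OF assms], of _ m]
  have "toggle (unzeta \<kappa> m) v = \<kappa> v" if v: "v \<in> \<mu>" "content v = c" for v
    unfolding toggle_def unzeta_off_nw_max[OF assms v(2)] unzeta_diag[OF v]
    using toggle_bounds(7)[OF disjI2[OF assms] v] off v(2) by simp
  then have "zeta \<nu> x (unzeta \<kappa> m) = (\<lambda>v\<in>\<mu>. \<kappa> v)"
    unfolding zeta_eq[OF unzeta_RPP[OF assms]] by (intro restrict_ext) (simp add: off)
  also have "\<dots> = \<kappa>" using RPP_Tab[OF assms] by (simp add: Tab_def PiE_restrict)
  finally show ?thesis .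
qed

lemma corner_value_unzeta:
  assumes "\<kappa> \<in> RPP \<mu>"
  shows "unzeta \<kappa> m x - nw_max (unzeta \<kappa> m) x = m"
  using unzeta_off_nw_max[OF assms, of x m] by (simp add: unzeta_corner)

lemma zeta_RPP:
  assumes "\<pi> \<in> RPP \<nu>"
  shows "zeta \<nu> x \<pi> \<in> RPP \<mu>"
proof -
  let ?\<kappa> = "zeta \<nu> x \<pi>"
  have diag: "?\<kappa> v = toggle \<pi> v" if "v \<in> \<mu>" "content v = c" for v
    using that by (simp add: zeta_eq[OF assms])
  have off: "?\<kappa> v = \<pi> v" if "v \<in> \<mu>" "content v \<noteq> c" for v
    using that by (simp add: zeta_eq[OF assms])
  have "?\<kappa> v \<le> ?\<kappa> w" if v: "v \<in> \<mu>" and w: "w \<in> \<mu>" "w = east v \<or> w = south v" for v w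
  proof -
    consider (1) "content v = c" | (2) "content w = c" | (3) "content v \<noteq> c" "content w \<noteq> c" by blast
    then show ?thesis
    proof cases
      case 1
      then show ?thesis using toggle_bounds(5,6)[OF disjI1[OF assms] v] v w off[of w] diag[of v] by auto
    next
      case 2
      then have "content v \<noteq> c" "v = west w \<or> v = north w" using w by auto
      then have "?\<kappa> v = \<pi> v" "\<pi> v \<le> nw_max \<pi> w" using off v by (auto simp: nw_max_def)
      then show ?thesis using toggle_bounds(4)[OF disjI1[OF assms] w(1) 2] diag[OF w(1) 2] by simp
    next
      case 3
      then show ?thesis using off v w RPP_east[OF young assms, of v] RPP_south[OF young assms, of v] by auto
    qed
  qed
  moreover have "?\<kappa> \<in> Tab \<mu>" by (simp add: zeta_def Tab_def)
  ultimately show ?thesis unfolding RPP_iff[OF young_mu] by blast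
qed

lemma unzeta_zeta:
  assumes "\<pi> \<in> RPP \<nu>"
  shows "unzeta (zeta \<nu> x \<pi>) (\<pi> x - nw_max \<pi> x) = \<pi>"
proof (rule Tab_eqI)
  let ?\<kappa> = "zeta \<nu> x \<pi>"
  show "unzeta ?\<kappa> (\<pi> x - nw_max \<pi> x) \<in> Tab \<nu>" "\<pi> \<in> Tab \<nu>"
    using unzeta_Tab RPP_Tab[OF assms] by simp_all
  have off: "?\<kappa> v = \<pi> v" if "v \<in> \<nu>" "content v \<noteq> c" for v
    using that by (auto simp: zeta_eq[OF assms])
  have nw: "nw_max ?\<kappa> v = nw_max \<pi> v" if "content v = c" for v
    by (rule nw_max_cong[OF that]) (rule off)
  fix v assume v: "v \<in> \<nu>"
  consider (1) "v = x" | (2) "v \<in> \<mu>" "content v = c" | (3) "content v \<noteq> c" using v by blast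
  then show "unzeta ?\<kappa> (\<pi> x - nw_max \<pi> x) v = \<pi> v"
  proof cases
    case 1
    have "nw_max \<pi> x \<le> \<pi> x"
      using RPP_north[OF young assms corner_mem] RPP_west[OF young assms corner_mem] by (simp add: nw_max_def)
    then show ?thesis using 1 nw[of x] by (simp add: unzeta_corner)
  next
    case 2
    then have "?\<kappa> v = toggle \<pi> v" by (simp add: zeta_eq[OF assms])
    then show ?thesis unfolding unzeta_diag[OF 2] toggle_def[of ?\<kappa>] nw[OF 2(2)]
      using toggle_bounds(7)[OF disjI1[OF assms] 2] mu_diag[OF 2] off 2(2) by simp
  next
    case 3
    then show ?thesis using unzeta_off[OF RPP_Tab[OF zeta_RPP[OF assms]]] off v by simp
  qed
qed

end

subsection \<open>Insertions with and without the corner\<close>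

lemma inc_Tab: "inc \<nu> \<pi> S \<in> Tab \<nu>"
  by (simp add: inc_def Tab_def)

lemma insertion_funD:
  assumes "insertion_fun \<nu> \<pi> d1 d0 g"
  shows "\<And>d. d1 < d \<Longrightarrow> d \<le> d0 \<Longrightarrow> g (d - 1) = sw_step \<nu> \<pi> (g d)"
    and "\<And>d. d1 \<le> d \<Longrightarrow> d \<le> d0 \<Longrightarrow> g d \<in> \<nu>"
    and "\<And>d. d1 \<le> d \<Longrightarrow> d \<le> d0 \<Longrightarrow> content (g d) = d"
    and "\<And>d. d1 \<le> d \<Longrightarrow> d < d0 \<Longrightarrow> hor \<nu> d \<Longrightarrow> \<pi> (g d) = \<pi> (g (d + 1))"
    and "\<And>v. v \<in> \<nu> \<Longrightarrow> content v = d1 \<Longrightarrow> fst (g d1) < fst v \<Longrightarrow> val0 \<nu> \<pi> (west v) = \<pi> v"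
  using assms unfolding insertion_fun_def by simp_all

lemma edge_eqD: "edge_eq \<nu> \<pi> d \<Longrightarrow> v \<in> \<nu> \<Longrightarrow> content v = d \<Longrightarrow> val0 \<nu> \<pi> (west v) = \<pi> v"
  by (simp add: edge_eq_def)

context corner
begin

text \<open>A step from diagonal d reads the boundary step at d - 1 and entries on d and d - 1, so
  only d = c and d = c + 1 can notice the corner.\<close>

lemma sw_step_mu:
  assumes "\<kappa> \<in> Tab \<mu>" "content v \<noteq> c" "content v \<noteq> c + 1"
  shows "sw_step \<nu> (unzeta \<kappa> m) v = sw_step \<mu> \<kappa> v"
  using hor_mu_iff[of "content v - 1"] unzeta_off[OF assms(1), of v m] unzeta_off[OF assms(1), of "south v" m] assms
  by (simp add: sw_step_def)

text \<open>Agreement of diagonals c and c + 1 in \<mu> becomes agreement of c - 1 and c in \<nu>.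
  The northern neighbour of v does not exceed the western one, so \<open>nw_max\<close> is the
  western entry; the eastern neighbour equals \<kappa> v, so the minimum is \<kappa> v and cancels.
  The hypotheses concern v alone because \<open>step_col\<close> knows the agreement only below the
  head of the path.\<close>

lemma unzeta_west:
  assumes rpp: "\<kappa> \<in> RPP \<mu>" and v: "v \<in> \<nu>" "content v = c"
    and north: "north v \<in> \<mu> \<Longrightarrow> val0 \<mu> \<kappa> (west (north v)) = \<kappa> (north v)"
    and east: "v \<noteq> x \<Longrightarrow> \<kappa> v = \<kappa> (east v)"
  shows "unzeta \<kappa> 0 v = val0 \<nu> \<kappa> (west v)"
proof -
  have "val0 \<nu> \<kappa> (north v) \<le> val0 \<nu> \<kappa> (west v)"
  proof (cases "north v \<in> \<mu> \<and> north (west v) \<in> \<mu>")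
    case True
    then have "west v \<in> \<mu>" using v mu_diag(2)[of "north (west v)"] by simp
    moreover have "\<kappa> (north v) = \<kappa> (north (west v))" using north True by simp
    ultimately show ?thesis using RPP_south[OF young_mu rpp, of "north (west v)"] True by simp
  next
    case False
    have "val0 \<nu> \<kappa> (north v) = 0"
    proof (cases "north v \<in> \<mu>")
      case True
      then have "val0 \<mu> \<kappa> (north (west v)) = 0" using False unfolding val0_def by metis
      then show ?thesis using north[OF True] True by simp
    next
      case False
      moreover have "north v \<noteq> x" using v(2) by (metis content.simps content_steps(1) add_cancel_left_right zero_neq_one)
      ultimately have "north v \<notin> \<nu>" by blast
      then show ?thesis by (simp add: val0_def)
    qed
    then show ?thesis by simp
  qed
  then have nw: "nw_max \<kappa> v = val0 \<nu> \<kappa> (west v)" by (simp add: nw_max_def)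
  show ?thesis
  proof (cases "v = x")
    case True
    then show ?thesis using nw by (simp add: unzeta_corner)
  next
    case False
    then have vm: "v \<in> \<mu>" using v by simp
    show ?thesis unfolding unzeta_diag[OF vm v(2)] toggle_def nw
      using east[OF False] toggle_bounds(3)[OF disjI2[OF rpp] vm v(2)] by simp
  qed
qed

lemma unzeta_edge_eq:
  assumes "\<kappa> \<in> RPP \<mu>" "edge_eq \<mu> \<kappa> (c + 1)" "v \<in> \<nu>" "content v = c"
  shows "unzeta \<kappa> 0 v = val0 \<nu> \<kappa> (west v)"
proof (rule unzeta_west[OF assms(1,3,4)])
  show "val0 \<mu> \<kappa> (west (north v)) = \<kappa> (north v)" if "north v \<in> \<mu>"
    using edge_eqD[OF assms(2) that] assms(4) by simp
  show "\<kappa> v = \<kappa> (east v)" if "v \<noteq> x"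
  proof -
    have "v \<in> \<mu>" "east v \<in> \<mu>" using that assms(3,4) mu_diag by simp_all
    then show ?thesis using edge_eqD[OF assms(2), of "east v"] assms(4) by simp
  qed
qed

lemma edge_eq_corner:
  assumes "\<kappa> \<in> RPP \<mu>" "edge_eq \<mu> \<kappa> (c + 1)"
  shows "edge_eq \<nu> (unzeta \<kappa> 0) c"
  unfolding edge_eq_def
proof (intro ballI impI)
  fix v assume v: "v \<in> \<nu>" "content v = c"
  have "val0 \<nu> (unzeta \<kappa> 0) (west v) = val0 \<nu> \<kappa> (west v)"
    using unzeta_off[OF RPP_Tab[OF assms(1)]] v(2) by (simp add: val0_def)
  then show "val0 \<nu> (unzeta \<kappa> 0) (west v) = unzeta \<kappa> 0 v" using unzeta_edge_eq[OF assms v] by simp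
qed

lemma edge_eq_off:
  assumes "\<kappa> \<in> RPP \<mu>" "edge_eq \<mu> \<kappa> d" "d \<noteq> c" "d - 1 \<noteq> c"
  shows "edge_eq \<nu> (unzeta \<kappa> m) d"
  using assms(2,3,4) unfolding edge_eq_def
  by (auto simp: unzeta_off[OF RPP_Tab[OF assms(1)]] val0_def)

lemma inc_corner: "unzeta \<kappa> (Suc m) = inc \<nu> (unzeta \<kappa> m) {x}"
  by (rule Tab_eqI[OF unzeta_Tab inc_Tab]) (auto simp: unzeta_def inc_def)

section \<open>Single insertions, by the position of the hook relative to the corner\<close>

lemma inc_far:
  assumes "\<And>v. v \<in> S \<Longrightarrow> content v \<noteq> c \<and> content v \<noteq> c + 1 \<and> content v \<noteq> c - 1"
  shows "unzeta (inc \<mu> \<kappa> S) m = inc \<nu> (unzeta \<kappa> m) S"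
proof (rule Tab_eqI[OF unzeta_Tab inc_Tab])
  fix v assume v: "v \<in> \<nu>"
  have near: "inc \<mu> \<kappa> S w = \<kappa> w" if "w \<in> \<mu>" "content w = c \<or> content w = c + 1 \<or> content w = c - 1" for w
    using that assms[of w] by (auto simp: inc_def)
  show "unzeta (inc \<mu> \<kappa> S) m v = inc \<nu> (unzeta \<kappa> m) S v"
  proof (cases "content v = c")
    case True
    then have "v \<notin> S" using assms[of v] by blast
    have nw: "nw_max (inc \<mu> \<kappa> S) v = nw_max \<kappa> v"
      using near[of "north v"] near[of "west v"] True mu_iff[of "north v"] mu_iff[of "west v"]
      by (simp add: nw_max_def val0_def)
    show ?thesis
    proof (cases "v = x")
      case True
      then show ?thesis using nw v \<open>v \<notin> S\<close> by (simp add: unzeta_corner inc_def)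
    next
      case False
      then have vm: "v \<in> \<mu>" using v by simp
      have "toggle (inc \<mu> \<kappa> S) v = toggle \<kappa> v"
        using nw near[OF vm] near[of "east v"] near[of "south v"] mu_diag[OF vm True] True by (simp add: toggle_def)
      then show ?thesis using v \<open>v \<notin> S\<close> unzeta_diag[OF vm True] by (simp add: inc_def)
    qed
  next
    case False
    then have "v \<noteq> x" by auto
    with False show ?thesis using v by (simp add: unzeta_def inc_def)
  qed
qed

text \<open>The path avoids the diagonals c - 1, c, c + 1. The excess is arbitrary because such
  hooks may follow hooks of the corner.\<close>

lemma step_far:
  assumes rpp: "\<kappa> \<in> RPP \<mu>" and g: "insertion_fun \<mu> \<kappa> d1 d0 g"
    and range: "d1 \<le> d0" "d0 \<le> c - 2 \<or> c + 2 \<le> d1"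
  shows "insertion_fun \<nu> (unzeta \<kappa> m) d1 d0 g"
    and "unzeta (inc \<mu> \<kappa> (g ` {d1..d0})) m = inc \<nu> (unzeta \<kappa> m) (g ` {d1..d0})"
proof -
  note gD = insertion_funD[OF g] and off = unzeta_off[OF RPP_Tab[OF rpp], of _ m]
  have out: "d \<noteq> c" "d \<noteq> c + 1" "d \<noteq> c - 1" if "d1 \<le> d" "d \<le> d0" for d
    using range that by linarith+
  show "insertion_fun \<nu> (unzeta \<kappa> m) d1 d0 g"
    unfolding insertion_fun_def
  proof (intro conjI allI ballI impI)
    show "g (d - 1) = sw_step \<nu> (unzeta \<kappa> m) (g d)" if "d1 < d" "d \<le> d0" for d
      using sw_step_mu[OF RPP_Tab[OF rpp], of "g d" m] gD(1,3)[of d] out[of d] that by simp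
    show "g d \<in> \<nu>" "content (g d) = d" if "d1 \<le> d" "d \<le> d0" for d
      using gD(2,3)[OF that] by simp_all
    show "unzeta \<kappa> m (g d) = unzeta \<kappa> m (g (d + 1))" if "d1 \<le> d" "d < d0" "hor \<nu> d" for d
      using gD(4)[of d] gD(3)[of d] gD(3)[of "d + 1"] out[of d] out[of "d + 1"] hor_mu_iff[of d] off that by simp
    show "val0 \<nu> (unzeta \<kappa> m) (west v) = unzeta \<kappa> m v"
      if v: "v \<in> \<nu>" "content v = d1" "fst (g d1) < fst v" for v
    proof -
      have "d1 \<noteq> c" "d1 - 1 \<noteq> c" using range by linarith+
      then show ?thesis using gD(5)[of v] v off[of v] off[of "west v"] mu_iff[of v] val0_mu[of "west v" \<kappa>]
        by (simp add: val0_def)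
    qed
  qed
  show "unzeta (inc \<mu> \<kappa> (g ` {d1..d0})) m = inc \<nu> (unzeta \<kappa> m) (g ` {d1..d0})"
    by (rule inc_far) (use gD(3) out in auto)
qed

text \<open>The new toggle is not computed. By \<open>up\<close>, the agreement of diagonals c and c
  + 1 in \<mu> survives the increment, so diagonal c of \<nu> copies diagonal c - 1 before and
  after. Hence \<open>S'\<close> has to meet diagonal c exactly one step east of where S meets
  diagonal c - 1.\<close>

lemma inc_cross:
  assumes rpp: "\<kappa> \<in> RPP \<mu>" "inc \<mu> \<kappa> S \<in> RPP \<mu>" and edge: "edge_eq \<mu> \<kappa> (c + 1)" and S: "S \<subseteq> \<mu>"
    and up: "\<And>v. v \<in> \<nu> \<Longrightarrow> content v = c + 1 \<Longrightarrow> v \<in> S \<longleftrightarrow> west v \<in> S"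
    and off: "\<And>v. content v \<noteq> c \<Longrightarrow> v \<in> S \<longleftrightarrow> v \<in> S'"
    and diag: "\<And>v. v \<in> \<nu> \<Longrightarrow> content v = c \<Longrightarrow> west v \<in> S \<longleftrightarrow> v \<in> S'"
  shows "unzeta (inc \<mu> \<kappa> S) 0 = inc \<nu> (unzeta \<kappa> 0) S'"
proof (rule Tab_eqI[OF unzeta_Tab inc_Tab])
  have val0_inc: "val0 \<mu> (inc \<mu> \<kappa> S) v = val0 \<mu> \<kappa> v + (if v \<in> S then 1 else 0)" for v
    using S by (auto simp: val0_def inc_def)
  have "edge_eq \<mu> (inc \<mu> \<kappa> S) (c + 1)"
    unfolding edge_eq_def
  proof (intro ballI impI)
    fix v assume v: "v \<in> \<mu>" "content v = c + 1"
    then have "val0 \<mu> \<kappa> (west v) = \<kappa> v" using edge by (simp add: edge_eq_def)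
    then show "val0 \<mu> (inc \<mu> \<kappa> S) (west v) = inc \<mu> \<kappa> S v"
      unfolding val0_inc using up[of v] v by (simp add: inc_def)
  qed
  note edge' = unzeta_edge_eq[OF rpp(2) this]
  fix v assume v: "v \<in> \<nu>"
  show "unzeta (inc \<mu> \<kappa> S) 0 v = inc \<nu> (unzeta \<kappa> 0) S' v"
  proof (cases "content v = c")
    case True
    have "unzeta (inc \<mu> \<kappa> S) 0 v = val0 \<mu> (inc \<mu> \<kappa> S) (west v)"
      using edge'[OF v True] True by (simp add: val0_mu)
    also have "\<dots> = val0 \<nu> \<kappa> (west v) + (if v \<in> S' then 1 else 0)"
      unfolding val0_inc using diag[OF v True] True by (simp add: val0_mu)
    finally show ?thesis using unzeta_edge_eq[OF rpp(1) edge v True] v by (simp add: inc_def)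
  next
    case False
    then have "v \<in> \<mu>" using v by auto
    with False show ?thesis
      using unzeta_off[OF inc_Tab False] unzeta_off[OF RPP_Tab[OF rpp(1)] False] off[OF False] v by (simp add: inc_def)
  qed
qed

text \<open>Between diagonals c + 1 and c - 1 the two paths take the same two steps in opposite
  order: in \<mu> a forced step west and then a choice, in \<nu> the choice and then a forced step
  west. By the agreement of diagonals, both choices compare \<kappa> y with \<kappa> at
  \<open>south (west y)\<close>.\<close>

lemma step_cross:
  assumes rpp: "\<kappa> \<in> RPP \<mu>" "inc \<mu> \<kappa> (g ` {d1..d0}) \<in> RPP \<mu>" and edge: "edge_eq \<mu> \<kappa> (c + 1)"
    and g: "insertion_fun \<mu> \<kappa> d1 d0 g" and range: "d1 \<le> c - 1" "c + 1 \<le> d0"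
  obtains g' where "insertion_fun \<nu> (unzeta \<kappa> 0) d1 d0 g'" "g' d0 = g d0"
    "unzeta (inc \<mu> \<kappa> (g ` {d1..d0})) 0 = inc \<nu> (unzeta \<kappa> 0) (g' ` {d1..d0})"
proof -
  note gD = insertion_funD[OF g] and off = unzeta_off[OF RPP_Tab[OF rpp(1)], of _ 0]
  define \<pi> where "\<pi> = unzeta \<kappa> 0"
  note off = off[folded \<pi>_def]
  define y where "y = g (c + 1)"
  define z where "z = sw_step \<nu> \<pi> y"
  define g' where "g' = g(c := z)"
  have y: "y \<in> \<mu>" "content y = c + 1" using gD(2,3)[of "c + 1"] range by (simp_all add: y_def)
  have "hor \<mu> c" using hor_mu[of y] y by simp
  then have gc: "g c = west y" using gD(1)[of "c + 1"] range y by (simp add: y_def[symmetric] sw_step_def)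
  then have wy: "west y \<in> \<mu>" using gD(2)[of c] range by simp
  then have swy: "south (west y) \<in> \<mu>" using mu_diag(2) y(2) by simp
  have "\<kappa> y = \<kappa> (west y)" using edge_eqD[OF edge y] wy by simp
  moreover have "g (c - 1) = sw_step \<mu> \<kappa> (west y)" using gD(1)[of c] gc range by simp
  ultimately have gc1: "g (c - 1) = (if \<kappa> y = \<kappa> (south (west y)) then south (west y) else west (west y))"
    using not_hor_low_mu y(2) by (simp add: sw_step_def)
  have sy: "south y \<in> \<nu>" using upper_diag(1)[of y] y by simp
  then have "\<pi> (south y) = \<kappa> (south (west y))"
    using unzeta_edge_eq[OF rpp(1) edge sy] y(2) swy by (simp add: \<pi>_def)
  then have z: "z = (if \<kappa> y = \<kappa> (south (west y)) then south y else west y)"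
    using not_hor_corner y(2) off[of y] by (simp add: z_def sw_step_def)
  have zm: "z \<in> \<nu>" "content z = c" using sy wy y(2) by (auto simp: z)
  have wz: "west z = g (c - 1)" by (simp add: z gc1)
  have stepz: "sw_step \<nu> \<pi> z = g (c - 1)" using hor_low zm(2) by (simp add: sw_step_def wz)
  have "insertion_fun \<nu> \<pi> d1 d0 g'"
    unfolding insertion_fun_def
  proof (intro conjI allI ballI impI)
    show "g' (d - 1) = sw_step \<nu> \<pi> (g' d)" if d: "d1 < d" "d \<le> d0" for d
    proof -
      consider "d = c + 1" | "d = c" | "d \<noteq> c" "d \<noteq> c + 1" by blast
      then show ?thesis
      proof cases
        case 1
        then show ?thesis by (simp add: g'_def z_def y_def)
      next
        case 2
        then show ?thesis by (simp add: g'_def stepz)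
      next
        case 3
        then show ?thesis using sw_step_mu[OF RPP_Tab[OF rpp(1)], of "g d" 0] gD(1,3)[of d] d
          by (simp add: g'_def \<pi>_def)
      qed
    qed
    show "g' d \<in> \<nu>" "content (g' d) = d" if "d1 \<le> d" "d \<le> d0" for d
      using gD(2,3)[OF that] zm by (auto simp: g'_def)
    show "\<pi> (g' d) = \<pi> (g' (d + 1))" if d: "d1 \<le> d" "d < d0" "hor \<nu> d" for d
    proof -
      have "d \<noteq> c" using d(3) not_hor_corner by auto
      show ?thesis
      proof (cases "d = c - 1")
        case True
        have "\<pi> z = \<kappa> (g (c - 1))"
          using unzeta_edge_eq[OF rpp(1) edge zm] gD(2)[of "c - 1"] range by (simp add: \<pi>_def wz)
        then show ?thesis using True off[of "g (c - 1)"] gD(3)[of "c - 1"] range by (simp add: g'_def)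
      next
        case False
        then show ?thesis using gD(4)[of d] gD(3)[of d] gD(3)[of "d + 1"] hor_mu_iff[of d] off d \<open>d \<noteq> c\<close>
          by (simp add: g'_def)
      qed
    qed
    show "val0 \<nu> \<pi> (west v) = \<pi> v"
      if v: "v \<in> \<nu>" "content v = d1" "fst (g' d1) < fst v" for v
      using gD(5)[of v] v off[of v] off[of "west v"] mu_iff[of v] val0_mu[of "west v" \<kappa>] range
      by (simp add: val0_def g'_def)
  qed
  moreover have "unzeta (inc \<mu> \<kappa> (g ` {d1..d0})) 0 = inc \<nu> \<pi> (g' ` {d1..d0})"
    unfolding \<pi>_def
  proof (rule inc_cross[OF rpp edge])
    have im: "v \<in> g ` {d1..d0} \<longleftrightarrow> d1 \<le> content v \<and> content v \<le> d0 \<and> g (content v) = v" for v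
      using gD(3) by (rule fun_image_iff)
    have im': "v \<in> g' ` {d1..d0} \<longleftrightarrow> d1 \<le> content v \<and> content v \<le> d0 \<and> g' (content v) = v" for v
      using gD(3) zm(2) by (intro fun_image_iff) (simp add: g'_def)
    show "g ` {d1..d0} \<subseteq> \<mu>" by (intro image_subsetI gD(2)) simp_all
    show "v \<in> g ` {d1..d0} \<longleftrightarrow> west v \<in> g ` {d1..d0}" if "v \<in> \<nu>" "content v = c + 1" for v
      unfolding im using that range gc y_def by auto
    show "v \<in> g ` {d1..d0} \<longleftrightarrow> v \<in> g' ` {d1..d0}" if "content v \<noteq> c" for v
      unfolding im im' using that by (simp add: g'_def)
    show "west v \<in> g ` {d1..d0} \<longleftrightarrow> v \<in> g' ` {d1..d0}" if "v \<in> \<nu>" "content v = c" for v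
      unfolding im im' using that range wz[symmetric] by (simp add: g'_def)
  qed
  ultimately show ?thesis using that[of g'] range by (simp add: g'_def \<pi>_def)
qed

text \<open>The path in \<nu> has x as an additional first cell; the boundary forces it west from
  there, to the start of the path in \<mu>.\<close>

lemma step_row:
  assumes rpp: "\<kappa> \<in> RPP \<mu>" "inc \<mu> \<kappa> (g ` {d1..c - 1}) \<in> RPP \<mu>" and edge: "edge_eq \<mu> \<kappa> (c + 1)"
    and g: "insertion_fun \<mu> \<kappa> d1 (c - 1) g" and range: "d1 \<le> c - 1" and start: "g (c - 1) = west x"
  obtains g' where "insertion_fun \<nu> (unzeta \<kappa> 0) d1 c g'" "g' c = x"
    "unzeta (inc \<mu> \<kappa> (g ` {d1..c - 1})) 0 = inc \<nu> (unzeta \<kappa> 0) (g' ` {d1..c})"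
proof -
  note gD = insertion_funD[OF g] and off = unzeta_off[OF RPP_Tab[OF rpp(1)], of _ 0]
  define \<pi> where "\<pi> = unzeta \<kappa> 0"
  note off = off[folded \<pi>_def]
  define g' where "g' = g(c := x)"
  have stepx: "sw_step \<nu> \<pi> x = g (c - 1)" using hor_low by (simp add: sw_step_def start)
  have "insertion_fun \<nu> \<pi> d1 c g'"
    unfolding insertion_fun_def
  proof (intro conjI allI ballI impI)
    show "g' (d - 1) = sw_step \<nu> \<pi> (g' d)" if d: "d1 < d" "d \<le> c" for d
    proof (cases "d = c")
      case True
      then show ?thesis using stepx by (simp add: g'_def)
    next
      case False
      then show ?thesis using sw_step_mu[OF RPP_Tab[OF rpp(1)], of "g d" 0] gD(1,3)[of d] d
        by (simp add: g'_def \<pi>_def)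
    qed
    show "g' d \<in> \<nu>" "content (g' d) = d" if "d1 \<le> d" "d \<le> c" for d
      using gD(2,3)[of d] that corner_mem by (auto simp: g'_def)
    show "\<pi> (g' d) = \<pi> (g' (d + 1))" if d: "d1 \<le> d" "d < c" "hor \<nu> d" for d
    proof (cases "d = c - 1")
      case True
      have "\<pi> x = \<kappa> (g (c - 1))"
        using unzeta_edge_eq[OF rpp(1) edge corner_mem] gD(2)[of "c - 1"] range start by (simp add: \<pi>_def)
      then show ?thesis using True off[of "g (c - 1)"] gD(3)[of "c - 1"] range by (simp add: g'_def)
    next
      case False
      then show ?thesis using gD(4)[of d] gD(3)[of d] gD(3)[of "d + 1"] hor_mu_iff[of d] off d
        by (simp add: g'_def)
    qed
    show "val0 \<nu> \<pi> (west v) = \<pi> v"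
      if v: "v \<in> \<nu>" "content v = d1" "fst (g' d1) < fst v" for v
      using gD(5)[of v] v off[of v] off[of "west v"] mu_iff[of v] val0_mu[of "west v" \<kappa>] range
      by (simp add: val0_def g'_def)
  qed
  moreover have "unzeta (inc \<mu> \<kappa> (g ` {d1..c - 1})) 0 = inc \<nu> \<pi> (g' ` {d1..c})"
    unfolding \<pi>_def
  proof (rule inc_cross[OF rpp edge])
    have im: "v \<in> g ` {d1..c - 1} \<longleftrightarrow> d1 \<le> content v \<and> content v \<le> c - 1 \<and> g (content v) = v" for v
      using gD(3) by (rule fun_image_iff)
    have im': "v \<in> g' ` {d1..c} \<longleftrightarrow> d1 \<le> content v \<and> content v \<le> c \<and> g' (content v) = v" for v
      using gD(3) by (intro fun_image_iff) (simp add: g'_def)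
    show "g ` {d1..c - 1} \<subseteq> \<mu>" by (intro image_subsetI gD(2)) simp_all
    show "v \<in> g ` {d1..c - 1} \<longleftrightarrow> west v \<in> g ` {d1..c - 1}" if "v \<in> \<nu>" "content v = c + 1" for v
      unfolding im using that by simp
    show "v \<in> g ` {d1..c - 1} \<longleftrightarrow> v \<in> g' ` {d1..c}" if "content v \<noteq> c" for v
      unfolding im im' using that by (auto simp: g'_def)
    show "west v \<in> g ` {d1..c - 1} \<longleftrightarrow> v \<in> g' ` {d1..c}" if "v \<in> \<nu>" "content v = c" for v
      unfolding im im' using that range start step_eq_iff(1)[of x v] by (simp add: g'_def del: west.simps)
  qed
  ultimately show ?thesis using that[of g'] by (simp add: g'_def \<pi>_def)
qed

text \<open>The path in \<nu> makes one more step, from y to diagonal c. Column b may already be in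
  use, so diagonals c and c + 1 of \<mu> need not agree throughout and the toggle is computed.
  Raising \<kappa> y by one raises either the maximum at \<open>south y\<close> or the minimum at
  \<open>west y\<close>, and z is that cell.\<close>

lemma step_col:
  assumes rpp: "\<kappa> \<in> RPP \<mu>" and g: "insertion_fun \<mu> \<kappa> (c + 1) d0 g" and range: "c + 1 \<le> d0"
  obtains g' where "insertion_fun \<nu> (unzeta \<kappa> 0) c d0 g'" "g' d0 = g d0"
    "unzeta (inc \<mu> \<kappa> (g ` {c + 1..d0})) 0 = inc \<nu> (unzeta \<kappa> 0) (g' ` {c..d0})"
proof -
  note gD = insertion_funD[OF g] and off = unzeta_off[OF RPP_Tab[OF rpp], of _ 0]
  define \<pi> where "\<pi> = unzeta \<kappa> 0"
  note off = off[folded \<pi>_def]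
  define y where "y = g (c + 1)"
  define z where "z = sw_step \<nu> \<pi> y"
  define g' where "g' = g(c := z)"
  \<comment> \<open>B competes with \<kappa> y, in the maximum for \<open>south y\<close> and in the
    minimum for \<open>west y\<close>. Outside \<nu> it defaults to 0, which sends the path
    south.\<close>
  define B where "B = val0 \<nu> \<kappa> (south (west y))"
  have y: "y \<in> \<mu>" "content y = c + 1" using gD(2,3)[of "c + 1"] range by (simp_all add: y_def)
  have sy: "south y \<in> \<nu>" using upper_diag(1)[of y] y by simp
  have below: "val0 \<mu> \<kappa> (west v) = \<kappa> v" if "v \<in> \<mu>" "content v = c + 1" "fst y < fst v" for v
    using gD(5)[OF that(1,2)] that(3) by (simp add: y_def)
  have fst_simps: "fst (north v) = fst v - 1" "fst (south v) = fst v + 1"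
    "fst (east v) = fst v" "fst (west v) = fst v" for v by (cases v; simp)+
  have low: "\<pi> v = val0 \<nu> \<kappa> (west v)" if v: "v \<in> \<nu>" "content v = c" "fst y + 1 < fst v" for v
    unfolding \<pi>_def
  proof (rule unzeta_west[OF rpp v(1,2)])
    show "val0 \<mu> \<kappa> (west (north v)) = \<kappa> (north v)" if "north v \<in> \<mu>"
      using below[OF that] v by (simp add: fst_simps)
    show "\<kappa> v = \<kappa> (east v)" if "v \<noteq> x"
    proof -
      have vm: "v \<in> \<mu>" using v(1) that by simp
      then show ?thesis using below[OF mu_diag(1)[OF vm v(2)]] v by (simp add: fst_simps)
    qed
  qed
  have nw_sy: "nw_max \<kappa> (south y) = max (\<kappa> y) B" using y(1) by (simp add: nw_max_def B_def)
  \<comment> \<open>Below y the diagonals c and c + 1 agree, so for \<open>south y\<close> different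
    from x the minimum in the toggle is the old entry and cancels.\<close>
  have \<pi>_sy: "\<pi> (south y) = max (\<kappa> y) B"
  proof (cases "south y = x")
    case True
    then show ?thesis using nw_sy unzeta_corner[of \<kappa> 0] by (simp add: \<pi>_def)
  next
    case False
    then have sm: "south y \<in> \<mu>" using sy by simp
    have sc: "content (south y) = c" using y(2) by simp
    have "\<kappa> (south y) = \<kappa> (east (south y))"
      using below[OF mu_diag(1)[OF sm sc]] sm y(2) by (simp add: fst_simps del: step_cancel(7))
    then show ?thesis
      unfolding \<pi>_def unzeta_diag[OF sm sc] toggle_def nw_sy
      using toggle_bounds(3)[OF disjI2[OF rpp] sm sc] by simp
  qed
  have z: "z = (if B \<le> \<kappa> y then south y else west y)"
    using not_hor_corner y(2) off[of y] by (auto simp: z_def sw_step_def \<pi>_sy max_def)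
  have wy: "west y \<in> \<mu>" if "\<not> B \<le> \<kappa> y"
  proof -
    have "south (west y) \<in> \<nu>" using that by (auto simp: B_def val0_def split: if_splits)
    moreover have "1 \<le> fst (west y)"
      using young_pos[OF young, of "fst y" "snd y"] y(1) by (simp add: fst_simps)
    ultimately have "west y \<in> \<nu>" by (rule mem_if_south[OF young])
    moreover have "west y \<noteq> x" using y(1) corner_east by (metis Diff_iff east.simps step_cancel(2))
    ultimately show ?thesis by simp
  qed
  have zm: "z \<in> \<nu>" "content z = c" using sy wy y(2) by (auto simp: z)
  have "insertion_fun \<nu> \<pi> c d0 g'"
    unfolding insertion_fun_def
  proof (intro conjI allI ballI impI)
    show "g' (d - 1) = sw_step \<nu> \<pi> (g' d)" if d: "c < d" "d \<le> d0" for d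
    proof (cases "d = c + 1")
      case True
      then show ?thesis by (simp add: g'_def z_def y_def)
    next
      case False
      then show ?thesis using sw_step_mu[OF RPP_Tab[OF rpp], of "g d" 0] gD(1,3)[of d] d
        by (simp add: g'_def \<pi>_def)
    qed
    show "g' d \<in> \<nu>" "content (g' d) = d" if "c \<le> d" "d \<le> d0" for d
      using gD(2,3)[of d] that zm by (auto simp: g'_def)
    show "\<pi> (g' d) = \<pi> (g' (d + 1))" if d: "c \<le> d" "d < d0" "hor \<nu> d" for d
    proof -
      have "d \<noteq> c" using d(3) not_hor_corner by auto
      then show ?thesis using gD(4)[of d] gD(3)[of d] gD(3)[of "d + 1"] hor_mu_iff[of d] off d
        by (simp add: g'_def)
    qed
    show "val0 \<nu> \<pi> (west v) = \<pi> v"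
      if v: "v \<in> \<nu>" "content v = c" "fst (g' c) < fst v" for v
    proof -
      have "\<pi> v = val0 \<nu> \<kappa> (west v)"
      proof (cases "fst y + 1 < fst v")
        case True
        then show ?thesis by (rule low[OF v(1,2)])
      next
        case False
        \<comment> \<open>If the path went west, \<open>south y\<close> now lies below its head as
          well; there the maximum is B, the entry to its west.\<close>
        then have "\<not> B \<le> \<kappa> y" "fst v = fst y + 1"
          using v(3) by (auto simp: g'_def z fst_simps split: if_splits)
        moreover from this have "v = south y" using v(2) y(2) by (cases v; cases y) auto
        ultimately show ?thesis using \<pi>_sy by (simp add: B_def)
      qed
      then show ?thesis using off[of "west v"] v(2) by (simp add: val0_def)
    qed
  qed
  moreover have "unzeta (inc \<mu> \<kappa> (g ` {c + 1..d0})) 0 = inc \<nu> \<pi> (g' ` {c..d0})"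
  proof (rule Tab_eqI[OF unzeta_Tab inc_Tab])
    let ?S = "g ` {c + 1..d0}" and ?S' = "g' ` {c..d0}"
    have im: "v \<in> ?S \<longleftrightarrow> c + 1 \<le> content v \<and> content v \<le> d0 \<and> g (content v) = v" for v
      using gD(3) by (rule fun_image_iff)
    have im': "v \<in> ?S' \<longleftrightarrow> c \<le> content v \<and> content v \<le> d0 \<and> g' (content v) = v" for v
      using gD(3) zm(2) by (intro fun_image_iff) (simp add: g'_def)
    have up: "w \<in> ?S \<longleftrightarrow> w = y" if "content w = c + 1" for w
      unfolding im using that range y_def by auto
    have down: "w \<notin> ?S" if "content w \<le> c" for w
      unfolding im using that by simp
    fix v assume v: "v \<in> \<nu>"
    show "unzeta (inc \<mu> \<kappa> ?S) 0 v = inc \<nu> \<pi> ?S' v"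
    proof (cases "content v = c")
      case False
      then have "v \<in> \<mu>" using v by auto
      moreover have "v \<in> ?S \<longleftrightarrow> v \<in> ?S'" unfolding im im' using False by (auto simp: g'_def)
      ultimately show ?thesis using unzeta_off[OF inc_Tab False] off[OF False] v by (simp add: inc_def)
    next
      case True
      have inS': "v \<in> ?S' \<longleftrightarrow> v = z" unfolding im' using True range by (auto simp: g'_def)
      have nw': "nw_max (inc \<mu> \<kappa> ?S) v =
          max (val0 \<nu> \<kappa> (north v) + (if north v = y then 1 else 0)) (val0 \<nu> \<kappa> (west v))"
        using up[of "north v"] down[of "west v"] True y(1) mu_iff[of "north v"] mu_iff[of "west v"]
        by (auto simp: nw_max_def val0_def inc_def)
      \<comment> \<open>The incremented y is the northern neighbour of v, entering its maximum, or
        the eastern one, entering its minimum, or neither.\<close>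
      consider (1) "north v = y" | (2) "east v = y" | (3) "north v \<noteq> y" "east v \<noteq> y" by blast
      then show ?thesis
      proof cases
        case 1
        then have vs: "v = south y" by auto
        have nw1: "nw_max (inc \<mu> \<kappa> ?S) v = max (\<kappa> y) B + (if B \<le> \<kappa> y then 1 else 0)"
          unfolding nw' using y(1) by (simp add: vs B_def)
        have zv: "v = z \<longleftrightarrow> B \<le> \<kappa> y" by (auto simp: z vs)
        show ?thesis
        proof (cases "v = x")
          case True
          then show ?thesis using nw1 \<pi>_sy unzeta_corner[of _ 0] inS' zv v vs by (simp add: inc_def)
        next
          case False
          then have vm: "v \<in> \<mu>" using v by simp
          note vc = \<open>content v = c\<close>
          have "east v \<noteq> y" using vs by (cases y) auto
          then have tog: "toggle (inc \<mu> \<kappa> ?S) v = nw_max (inc \<mu> \<kappa> ?S) v + min (\<kappa> (east v)) (\<kappa> (south v)) - \<kappa> v"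
            using mu_diag[OF vm vc] vm up[of "east v"] down[of v] down[of "south v"] vc
            by (simp add: toggle_def inc_def)
          have "\<pi> v = nw_max \<kappa> v + min (\<kappa> (east v)) (\<kappa> (south v)) - \<kappa> v"
            unfolding \<pi>_def unzeta_diag[OF vm vc] toggle_def ..
          moreover have le: "\<kappa> v \<le> min (\<kappa> (east v)) (\<kappa> (south v))"
            using toggle_bounds(2,3)[OF disjI2[OF rpp] vm vc] by simp
          ultimately have "toggle (inc \<mu> \<kappa> ?S) v = \<pi> v + (if B \<le> \<kappa> y then 1 else 0)"
            using tog nw1 nw_sy[folded vs] by linarith
          then show ?thesis unfolding unzeta_diag[OF vm vc]
            using inS' zv v by (simp add: inc_def)
        qed
      next
        case 2
        then have vw: "v = west y" by auto
        have vm: "v \<in> \<mu>" using v 2 y(1) corner_east by auto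
        have "north v \<noteq> y" using vw by (cases y) auto
        then have nw2: "nw_max (inc \<mu> \<kappa> ?S) v = nw_max \<kappa> v" unfolding nw' by (simp add: nw_max_def)
        note d = mu_diag[OF vm True]
        have B: "\<kappa> (south v) = B" using d(2) by (simp add: B_def vw)
        have "toggle (inc \<mu> \<kappa> ?S) v = nw_max \<kappa> v + min (\<kappa> y + 1) B - \<kappa> v"
          using d vm up[of "east v"] down[of v] down[of "south v"] True nw2 2 B y(2)
          by (simp add: toggle_def inc_def)
        moreover have "\<pi> v = nw_max \<kappa> v + min (\<kappa> y) B - \<kappa> v"
          unfolding \<pi>_def unzeta_diag[OF vm True] toggle_def 2 B ..
        moreover have "\<kappa> v \<le> \<kappa> y" "\<kappa> v \<le> B"
          using toggle_bounds(2,3)[OF disjI2[OF rpp] vm True] 2 B by simp_all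
        ultimately have "toggle (inc \<mu> \<kappa> ?S) v = \<pi> v + (if B \<le> \<kappa> y then 0 else 1)"
          by (cases "B \<le> \<kappa> y"; simp; linarith?)
        moreover have "v = z \<longleftrightarrow> \<not> B \<le> \<kappa> y" by (auto simp: z vw)
        ultimately show ?thesis unfolding unzeta_diag[OF vm True]
          using inS' v by (simp add: inc_def)
      next
        case 3
        then have zv: "v \<noteq> z" by (auto simp: z)
        have nw3: "nw_max (inc \<mu> \<kappa> ?S) v = nw_max \<kappa> v" unfolding nw' using 3 by (simp add: nw_max_def)
        show ?thesis
        proof (cases "v = x")
          case True
          then show ?thesis using nw3 inS' zv v unzeta_corner[of _ 0] by (simp add: inc_def \<pi>_def)
        next
          case False
          then have vm: "v \<in> \<mu>" using v by simp
          note vc = \<open>content v = c\<close>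
          have "toggle (inc \<mu> \<kappa> ?S) v = toggle \<kappa> v"
            using mu_diag[OF vm vc] vm up[of "east v"] down[of v] down[of "south v"] vc nw3 3(2)
            by (simp add: toggle_def inc_def)
          then show ?thesis using inS' zv v unzeta_diag[OF vm vc] by (simp add: inc_def \<pi>_def)
        qed
      qed
    qed
  qed
  ultimately show ?thesis using that[of g'] range by (simp add: g'_def \<pi>_def)
qed

end

section \<open>Sequences of insertions and the induction over corners\<close>

definition build :: "cell set \<Rightarrow> cell list \<Rightarrow> cell \<Rightarrow> nat" where
  "build \<nu> us = foldr (insert_hook \<nu>) (map (hook_at \<nu>) us) (zero_rpp \<nu>)"

lemma build_Nil: "build \<nu> [] = zero_rpp \<nu>"
  and build_Cons: "build \<nu> (u # us) = insert_hook \<nu> (hook_at \<nu> u) (build \<nu> us)"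
  by (simp_all add: build_def)

definition insertable :: "cell set \<Rightarrow> (cell \<Rightarrow> nat) \<Rightarrow> int \<Rightarrow> int \<Rightarrow> (int \<Rightarrow> cell) \<Rightarrow> bool" where
  "insertable \<nu> \<pi> i j g \<longleftrightarrow> insertion_fun \<nu> \<pi> (j - col_len \<nu> j) (row_len \<nu> i - i) g \<and>
     g (row_len \<nu> i - i) = (i, row_len \<nu> i) \<and>
     inc \<nu> \<pi> (g ` {j - col_len \<nu> j..row_len \<nu> i - i}) \<in> RPP \<nu>"

lemma insertableD:
  assumes "young \<nu>" "(i, j) \<in> \<nu>" "insertable \<nu> \<pi> i j g"
  shows "insert_hook \<nu> (hook_at \<nu> (i, j)) \<pi> = inc \<nu> \<pi> (g ` {j - col_len \<nu> j..row_len \<nu> i - i})"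
  using assms insert_hook_fun unfolding insertable_def by blast

text \<open>Quantifying over all sorted lists and all admissible next cells lets the property of
  \<mu> be applied to lists with the copies of x removed. The middle clause is the first invariant,
  with (1, j) marking a nonempty column; the second invariant is inside
  \<open>insertable\<close>.\<close>

definition good :: "cell set \<Rightarrow> bool" where
  "good \<nu> \<longleftrightarrow> (\<forall>us. sorted_wrt revlex_le us \<longrightarrow> set us \<subseteq> \<nu> \<longrightarrow>
     build \<nu> us \<in> RPP \<nu> \<and>
     (\<forall>j. (1, j) \<in> \<nu> \<longrightarrow> (\<forall>i. (i, j) \<notin> set us) \<longrightarrow> edge_eq \<nu> (build \<nu> us) (j - col_len \<nu> j)) \<and>
     (\<forall>i j. (i, j) \<in> \<nu> \<longrightarrow> sorted_wrt revlex_le ((i, j) # us) \<longrightarrow>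
        (\<exists>g. insertable \<nu> (build \<nu> us) i j g)))"

lemma goodD:
  assumes "good \<nu>" "sorted_wrt revlex_le us" "set us \<subseteq> \<nu>"
  shows "build \<nu> us \<in> RPP \<nu>"
    and "\<And>j. (1, j) \<in> \<nu> \<Longrightarrow> (\<And>i. (i, j) \<notin> set us) \<Longrightarrow> edge_eq \<nu> (build \<nu> us) (j - col_len \<nu> j)"
    and "\<And>i j. (i, j) \<in> \<nu> \<Longrightarrow> sorted_wrt revlex_le ((i, j) # us) \<Longrightarrow>
      \<exists>g. insertable \<nu> (build \<nu> us) i j g"
  using assms unfolding good_def by blast+

context corner
begin

lemma zero_unzeta: "zero_rpp \<nu> = unzeta (zero_rpp \<mu>) 0"
proof (rule Tab_eqI[OF _ unzeta_Tab])
  show "zero_rpp \<nu> \<in> Tab \<nu>" by (simp add: zero_rpp_def Tab_def)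
  fix v assume v: "v \<in> \<nu>"
  have z: "val0 \<nu> (zero_rpp \<mu>) w = 0" if "content w \<noteq> c" for w
    using that by (auto simp: val0_def zero_rpp_def)
  have nw: "nw_max (zero_rpp \<mu>) v = 0" if "content v = c"
    using z[of "north v"] z[of "west v"] that by (simp add: nw_max_def)
  consider (1) "v = x" | (2) "v \<in> \<mu>" "content v = c" | (3) "content v \<noteq> c" using v by blast
  then show "zero_rpp \<nu> v = unzeta (zero_rpp \<mu>) 0 v"
  proof cases
    case 1
    then show ?thesis using nw v by (simp add: unzeta_corner zero_rpp_def)
  next
    case 2
    then show ?thesis using nw v mu_diag[OF 2] by (simp add: unzeta_diag toggle_def zero_rpp_def)
  next
    case 3
    then have "v \<in> \<mu>" using v by auto
    then show ?thesis using 3 v by (simp add: unzeta_def zero_rpp_def)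
  qed
qed

context
  fixes us \<kappa> m
  assumes good: "good \<mu>" and sorted: "sorted_wrt revlex_le us" and subset: "set us \<subseteq> \<nu>"
  defines "\<kappa> \<equiv> build \<mu> (filter (\<lambda>u. u \<noteq> (a, b)) us)" and "m \<equiv> count_list us (a, b)"
begin

lemma sorted_filter: "sorted_wrt revlex_le (filter (\<lambda>u. u \<noteq> x) us)"
  and filter_subset: "set (filter (\<lambda>u. u \<noteq> x) us) \<subseteq> \<mu>"
  using sorted subset by (auto intro: sorted_wrt_filter)

lemmas good_mu = goodD[OF good sorted_filter filter_subset, folded \<kappa>_def]

text \<open>For a = 1 column b is missing from \<mu>, but then diagonal c + 1 is empty and the
  agreement is vacuous.\<close>

lemma edge_eq_mu:
  assumes "\<And>i. (i, b) \<notin> set us"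
  shows "edge_eq \<mu> \<kappa> (c + 1)"
proof (cases "a = 1")
  case True
  have "v \<notin> \<mu>" if "content v = c + 1" for v
  proof
    assume v: "v \<in> \<mu>"
    then have "1 \<le> fst v" using young_pos[OF young_mu, of "fst v" "snd v"] by simp
    then show False using upper_diag(2)[of v] v that True by simp
  qed
  then show ?thesis unfolding edge_eq_def by blast
next
  case False
  then have "(1, b) \<in> \<mu>" using young_down[OF young corner_mem, of 1 b] a_pos b_pos by simp
  then have "edge_eq \<mu> \<kappa> (b - col_len \<mu> b)" by (rule good_mu(2)) (use assms in simp)
  moreover have "b - col_len \<mu> b = c + 1" by (simp add: col_len_corner)
  ultimately show ?thesis by (simp only:)
qed

lemma edge_eq_nu:
  assumes j: "(1, j) \<in> \<nu>" and empty: "\<And>i. (i, j) \<notin> set us"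
  shows "edge_eq \<nu> (unzeta \<kappa> m) (j - col_len \<nu> j)"
proof (cases "j = b")
  case True
  then have "m = 0" using empty by (simp add: m_def count_list_0_iff)
  moreover have "edge_eq \<mu> \<kappa> (c + 1)" using edge_eq_mu empty True by blast
  ultimately show ?thesis using edge_eq_corner[OF good_mu(1)] True by (simp add: col_len_corner)
next
  case False
  have "1 \<le> j" using young_pos[OF young j] by simp
  have "edge_eq \<mu> \<kappa> (j - col_len \<mu> j)" by (rule good_mu(2)) (use j False empty in auto)
  \<comment> \<open>Bottom cells of columns left of b have content at most c - 1, those right of b
    at least c + 2, so their bottom edges do not border diagonal c.\<close>
  moreover have "j - col_len \<nu> j \<noteq> c \<and> j - col_len \<nu> j - 1 \<noteq> c"
  proof (cases "j < b")
    case True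
    then have "(a, j) \<in> \<nu>" using young_down[OF young corner_mem, of a j] \<open>1 \<le> j\<close> a_pos by simp
    then have "a \<le> col_len \<nu> j" unfolding mem_col[OF young] by simp
    then show ?thesis using True by linarith
  next
    case False
    have "(a, j) \<notin> \<nu>"
      using diag_compare[OF young _ corner_east, of a j] a_pos b_pos False \<open>j \<noteq> b\<close> by auto
    then have "col_len \<nu> j < a" unfolding mem_col[OF young] using a_pos by simp
    then show ?thesis using False \<open>j \<noteq> b\<close> by linarith
  qed
  ultimately show ?thesis using edge_eq_off[OF good_mu(1)] False by (simp add: col_len_mu)
qed

text \<open>One insertion commutes with \<open>unzeta\<close>. For a hook other than that of x,
  \<open>good\<close> supplies the path in \<mu>, which is transported by the lemma for its
  position.\<close>

lemma insertable_nu: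
  assumes ij: "(i, j) \<in> \<nu>" and sorted_Cons: "sorted_wrt revlex_le ((i, j) # us)"
  obtains g where "insertable \<nu> (unzeta \<kappa> m) i j g"
    "inc \<nu> (unzeta \<kappa> m) (g ` {j - col_len \<nu> j..row_len \<nu> i - i}) =
      unzeta (build \<mu> (filter (\<lambda>u. u \<noteq> x) ((i, j) # us))) (count_list ((i, j) # us) x)"
proof (cases "(i, j) = x")
  case True
  let ?g = "\<lambda>_::int. x"
  have "insertion_fun \<nu> (unzeta \<kappa> m) c c ?g"
    unfolding insertion_fun_def
  proof (intro conjI allI ballI impI)
    fix v assume v: "v \<in> \<nu>" "content v = c" "fst x < fst v"
    then show "val0 \<nu> (unzeta \<kappa> m) (west v) = unzeta \<kappa> m v"
      using diag_compare[OF young _ corner_south, of "fst v" "snd v"] a_pos b_pos by (cases v) auto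
  qed (use corner_mem in auto)
  moreover have eq: "inc \<nu> (unzeta \<kappa> m) {x} =
      unzeta (build \<mu> (filter (\<lambda>u. u \<noteq> x) ((i, j) # us))) (count_list ((i, j) # us) x)"
    using True by (simp add: inc_corner[symmetric] \<kappa>_def m_def)
  moreover have "inc \<nu> (unzeta \<kappa> m) {x} \<in> RPP \<nu>"
    unfolding inc_corner[symmetric] by (rule unzeta_RPP[OF good_mu(1)])
  ultimately show ?thesis using True that[of ?g] by (simp add: insertable_def row_len_corner col_len_corner)
next
  case False
  have pos: "1 \<le> i" "1 \<le> j" using young_pos[OF young ij] by simp_all
  have ijm: "(i, j) \<in> \<mu>" using ij False by simp
  have "sorted_wrt revlex_le ((i, j) # filter (\<lambda>u. u \<noteq> x) us)"
    using sorted_Cons sorted_filter by simp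
  then obtain g where g: "insertable \<mu> \<kappa> i j g" using good_mu(3)[OF ijm] by blast
  define d1 where "d1 = j - col_len \<mu> j"
  define d0 where "d0 = row_len \<mu> i - i"
  define e1 where "e1 = j - col_len \<nu> j"
  define e0 where "e0 = row_len \<nu> i - i"
  have gf: "insertion_fun \<mu> \<kappa> d1 d0 g" and start: "g d0 = (i, row_len \<mu> i)"
    and rpp: "inc \<mu> \<kappa> (g ` {d1..d0}) \<in> RPP \<mu>"
    using g by (simp_all add: insertable_def d1_def d0_def)
  have build: "build \<mu> (filter (\<lambda>u. u \<noteq> x) ((i, j) # us)) = inc \<mu> \<kappa> (g ` {d1..d0})"
    using insertableD[OF young_mu ijm g] False by (simp add: build_Cons \<kappa>_def d1_def d0_def)
  have count: "count_list ((i, j) # us) x = m" using False by (simp add: m_def)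
  have "\<exists>g'. insertion_fun \<nu> (unzeta \<kappa> m) e1 e0 g' \<and> g' e0 = (i, row_len \<nu> i) \<and>
      unzeta (inc \<mu> \<kappa> (g ` {d1..d0})) m = inc \<nu> (unzeta \<kappa> m) (g' ` {e1..e0})"
  proof -
    have range: "e1 \<le> e0" using ij mem_row[OF young, of i j] mem_col[OF young, of i j]
      by (simp add: e1_def e0_def)
    \<comment> \<open>\<open>us\<close> holds the cells inserted before (i, j). So x is not among
      them, and the excess is 0, as soon as (i, j) lies weakly north-west of x.\<close>
    have order: "l < j \<or> (l = j \<and> k \<le> i)" if "(k, l) \<in> set us" for k l

    proof -
      have "revlex_le (i, j) (k, l)" using sorted_Cons that by (simp del: revlex_le.simps)
      then show ?thesis by auto
    qed
    have "i \<noteq> a \<or> j \<noteq> b" using False by simp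
    then consider (far) "a < i \<or> b < j" | (cross) "i < a" "j < b" | (row) "i = a" "j < b" | (col) "i < a" "j = b"
      by linarith
    then show ?thesis
    proof cases
      case far
      have "e0 \<le> c - 2 \<and> i \<noteq> a \<and> j \<noteq> b" if i: "a < i"
      proof -
        have "(i, b) \<notin> \<nu>" using diag_compare[OF young _ corner_south, of i b] a_pos b_pos i by auto
        then have "row_len \<nu> i < b" unfolding mem_row[OF young] using b_pos by simp
        then show ?thesis using i ij \<open>(i, b) \<notin> \<nu>\<close> by (auto simp: e0_def)
      qed
      moreover have "c + 2 \<le> e1 \<and> i \<noteq> a \<and> j \<noteq> b" if j: "b < j"
      proof -
        have "(a, j) \<notin> \<nu>" using diag_compare[OF young _ corner_east, of a j] a_pos b_pos j by auto
        then have "col_len \<nu> j < a" unfolding mem_col[OF young] using a_pos by simp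
        then show ?thesis using j ij \<open>(a, j) \<notin> \<nu>\<close> by (auto simp: e1_def)
      qed
      ultimately have out: "e0 \<le> c - 2 \<or> c + 2 \<le> e1" "i \<noteq> a" "j \<noteq> b" using far by auto
      then have "d1 = e1" "d0 = e0" "row_len \<mu> i = row_len \<nu> i"
        by (simp_all add: d1_def d0_def e1_def e0_def row_len_mu col_len_mu)
      then show ?thesis using step_far[OF good_mu(1), of e1 e0 g m] gf start range out(1) by auto
    next
      case cross
      have "(k, b) \<notin> set us" for k using order[of k b] cross by auto
      then have m0: "m = 0" and edge: "edge_eq \<mu> \<kappa> (c + 1)"
        using edge_eq_mu by (auto simp: m_def count_list_0_iff)
      have "(i, b) \<in> \<nu>" "(a, j) \<in> \<nu>" using young_down[OF young corner_mem] pos cross a_pos b_pos by simp_all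
      then have "b \<le> row_len \<nu> i" "a \<le> col_len \<nu> j"
        using mem_row[OF young, of i b] mem_col[OF young, of a j] by simp_all
      then have ends: "e1 \<le> c - 1" "c + 1 \<le> e0" using cross by (simp_all add: e1_def e0_def)
      have same: "d1 = e1" "d0 = e0" "row_len \<mu> i = row_len \<nu> i"
        using cross by (simp_all add: d1_def d0_def e1_def e0_def row_len_mu col_len_mu)
      obtain g' where "insertion_fun \<nu> (unzeta \<kappa> 0) e1 e0 g'" "g' e0 = g e0"
        "unzeta (inc \<mu> \<kappa> (g ` {e1..e0})) 0 = inc \<nu> (unzeta \<kappa> 0) (g' ` {e1..e0})"
        by (rule step_cross[OF good_mu(1) rpp[unfolded same(1,2)] edge gf[unfolded same(1,2)] ends])
      then show ?thesis using m0 same start by auto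
    next
      case row
      have "(k, b) \<notin> set us" for k using order[of k b] row by auto
      then have m0: "m = 0" and edge: "edge_eq \<mu> \<kappa> (c + 1)"
        using edge_eq_mu by (auto simp: m_def count_list_0_iff)
      have "(a, j) \<in> \<nu>" using ij row by simp
      then have "a \<le> col_len \<nu> j" using mem_col[OF young, of a j] by simp
      then have ends: "e1 \<le> c - 1" "e0 = c" using row by (simp_all add: e1_def e0_def row_len_corner)
      have d0: "d0 = c - 1" using row by (simp add: d0_def row_len_corner)
      have same: "d1 = e1" "row_len \<nu> i = b"
        using row by (simp_all add: d1_def e1_def row_len_corner col_len_mu)
      have gc: "g (c - 1) = west x" using start unfolding d0 row(1) row_len_corner(2) by simp
      obtain g' where "insertion_fun \<nu> (unzeta \<kappa> 0) e1 c g'" "g' c = x"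
        "unzeta (inc \<mu> \<kappa> (g ` {e1..c - 1})) 0 = inc \<nu> (unzeta \<kappa> 0) (g' ` {e1..c})"
        by (rule step_row[where g = g,
              OF good_mu(1) rpp[unfolded same(1) d0] edge gf[unfolded same(1) d0] ends(1) gc])
      then show ?thesis unfolding m0 same(1) d0 ends(2) row(1) row_len_corner(1) by blast
    next
      case col
      have m0: "m = 0" using order[of a b] col by (auto simp: m_def count_list_0_iff)
      have "(i, b) \<in> \<nu>" using ij col by simp
      then have "b \<le> row_len \<nu> i" using mem_row[OF young, of i b] by simp
      then have ends: "e1 = c" "c + 1 \<le> e0" using col by (simp_all add: e1_def e0_def col_len_corner)
      have same: "d1 = c + 1" "d0 = e0" "row_len \<mu> i = row_len \<nu> i"
        using col by (simp_all add: d1_def d0_def e1_def e0_def row_len_mu col_len_corner)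
      obtain g' where "insertion_fun \<nu> (unzeta \<kappa> 0) c e0 g'" "g' e0 = g e0"
        "unzeta (inc \<mu> \<kappa> (g ` {c + 1..e0})) 0 = inc \<nu> (unzeta \<kappa> 0) (g' ` {c..e0})"
        by (rule step_col[OF good_mu(1) gf[unfolded same(1,2)] ends(2)])
      then show ?thesis using m0 same start ends(1) by auto
    qed
  qed
  then obtain g' where g': "insertion_fun \<nu> (unzeta \<kappa> m) e1 e0 g'" "g' e0 = (i, row_len \<nu> i)"
    and eq: "unzeta (inc \<mu> \<kappa> (g ` {d1..d0})) m = inc \<nu> (unzeta \<kappa> m) (g' ` {e1..e0})" by blast
  have "inc \<nu> (unzeta \<kappa> m) (g' ` {e1..e0}) \<in> RPP \<nu>" unfolding eq[symmetric] by (rule unzeta_RPP[OF rpp])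
  then have "insertable \<nu> (unzeta \<kappa> m) i j g'"
    unfolding insertable_def e1_def[symmetric] e0_def[symmetric] using g' by blast
  then show ?thesis by (rule that[of g']) (simp only: build count eq e1_def[symmetric] e0_def[symmetric])
qed

end

lemma build_unzeta:
  assumes good: "good \<mu>"
  shows "sorted_wrt revlex_le us \<Longrightarrow> set us \<subseteq> \<nu> \<Longrightarrow>
    build \<nu> us = unzeta (build \<mu> (filter (\<lambda>u. u \<noteq> x) us)) (count_list us x)"
proof (induction us)
  case Nil
  then show ?case using zero_unzeta by (simp add: build_Nil)
next
  case (Cons u us)
  obtain i j where u: "u = (i, j)" by fastforce
  have us: "sorted_wrt revlex_le us" "set us \<subseteq> \<nu>" "(i, j) \<in> \<nu>" "sorted_wrt revlex_le ((i, j) # us)"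
    using Cons.prems u by simp_all
  note IH = Cons.IH[OF us(1,2)]
  obtain g where "insertable \<nu> (build \<nu> us) i j g"
    "inc \<nu> (build \<nu> us) (g ` {j - col_len \<nu> j..row_len \<nu> i - i}) =
      unzeta (build \<mu> (filter (\<lambda>u. u \<noteq> x) ((i, j) # us))) (count_list ((i, j) # us) x)"
    unfolding IH by (rule insertable_nu[OF good us])
  then show ?case unfolding u build_Cons using insertableD[OF young us(3)] by simp
qed

lemma good_nu:
  assumes good: "good \<mu>"
  shows "good \<nu>"
  unfolding good_def
proof (intro allI impI conjI)
  fix us assume us: "sorted_wrt revlex_le us" "set us \<subseteq> \<nu>"
  note b = build_unzeta[OF good us]
  show "build \<nu> us \<in> RPP \<nu>" unfolding b by (rule unzeta_RPP[OF good_mu(1)[OF good us]])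
  show "edge_eq \<nu> (build \<nu> us) (j - col_len \<nu> j)" if "(1, j) \<in> \<nu>" "\<forall>i. (i, j) \<notin> set us" for j
    unfolding b using edge_eq_nu[OF good us that(1)] that(2) by blast
  show "\<exists>g. insertable \<nu> (build \<nu> us) i j g" if "(i, j) \<in> \<nu>" "sorted_wrt revlex_le ((i, j) # us)" for i j
    unfolding b using insertable_nu[OF good us that] by metis
qed

end

lemma corner_locale:
  assumes "young \<nu>" "outer_corner \<nu> x"
  shows "corner \<nu> (fst x) (snd x)"
  using assms by (cases x) (simp add: corner_def outer_corner_def)

lemma good_young: "young \<nu> \<Longrightarrow> good \<nu>"
proof (induction "card \<nu>" arbitrary: \<nu> rule: less_induct)
  case less
  show ?case
  proof (cases "\<nu> = {}")
    case True
    have "build {} [] \<in> RPP {}" by (auto simp: build_Nil zero_rpp_def RPP_def Tab_def)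
    then show ?thesis using True by (simp add: good_def)
  next
    case False
    then obtain x where x: "outer_corner \<nu> x" using ex_outer_corner[OF less.prems] by blast
    then have "card (\<nu> - {x}) < card \<nu>"
      using young_finite[OF less.prems] by (intro psubset_card_mono) (auto simp: outer_corner_def)
    then have "good (\<nu> - {x})" using less.hyps young_remove_corner[OF less.prems x] by blast
    then show ?thesis using corner.good_nu[OF corner_locale[OF less.prems x]] by simp
  qed
qed

subsection \<open>Sorted lists of cells\<close>

lemma revlex_le_total: "revlex_le u v \<or> revlex_le v u"
  by (cases u; cases v) auto

lemma revlex_le_trans: "revlex_le u v \<Longrightarrow> revlex_le v w \<Longrightarrow> revlex_le u w"
  by (cases u; cases v; cases w) auto

lemma revlex_le_antisym: "revlex_le u v \<Longrightarrow> revlex_le v u \<Longrightarrow> u = v"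
  by (cases u; cases v) auto

lemma ex_sorted_revlex: "\<exists>us. mset us = M \<and> sorted_wrt revlex_le us"
proof (induction M)
  case empty
  show ?case by (intro exI[of _ "[]"]) simp
next
  case (add u M)
  then obtain us where us: "mset us = M" "sorted_wrt revlex_le us" by blast
  let ?vs = "filter (\<lambda>v. \<not> revlex_le u v) us @ u # filter (revlex_le u) us"
  have "mset ?vs = add_mset u M" using us(1) by (simp add: multiset_eq_iff)
  moreover have "revlex_le v u" if "\<not> revlex_le u v" for v using that revlex_le_total by blast
  then have "\<forall>v\<in>set us. \<not> revlex_le u v \<longrightarrow> revlex_le v u \<and> (\<forall>w. revlex_le u w \<longrightarrow> revlex_le v w)"
    using revlex_le_trans by blast
  then have "sorted_wrt revlex_le ?vs"
    unfolding sorted_wrt_append sorted_wrt.simps using us(2)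
    by (intro conjI sorted_wrt_filter ballI) (force simp del: revlex_le.simps)+
  ultimately show ?case by blast
qed

text \<open>Each first element would precede the other, so antisymmetry identifies them. This is the
  uniqueness behind \<open>hook_list\<close>.\<close>

lemma sorted_wrt_mset_unique:
  assumes "\<And>u v. u \<in> set xs \<Longrightarrow> v \<in> set xs \<Longrightarrow> R u v \<Longrightarrow> R v u \<Longrightarrow> u = v"
  shows "sorted_wrt R xs \<Longrightarrow> sorted_wrt R ys \<Longrightarrow> mset xs = mset ys \<Longrightarrow> xs = ys"
  using assms
proof (induction xs arbitrary: ys)
  case Nil
  then show ?case by simp
next
  case (Cons u xs)
  then obtain v zs where ys: "ys = v # zs" by (cases ys) auto
  have set: "set (u # xs) = set ys" using Cons.prems(3) by (rule mset_eq_setD)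
  have "u = v"
  proof (rule ccontr)
    assume ne: "u \<noteq> v"
    then have "v \<in> set xs" "u \<in> set zs" using set ys by auto
    then have "R u v" "R v u" using Cons.prems(1,2) ys by auto
    then show False using Cons.prems(4)[of u v] ne \<open>v \<in> set xs\<close> by simp
  qed
  moreover have "xs = zs"
    by (rule Cons.IH) (use Cons.prems ys \<open>u = v\<close> in auto)
  ultimately show ?case using ys by simp
qed

lemma hook_le_antisym:
  assumes young: "young \<nu>" and "hook_le \<nu> g h" "hook_le \<nu> h g"
  shows "g = h"
proof -
  obtain u v where uv: "u \<in> \<nu>" "v \<in> \<nu>" "g = hook_at \<nu> u" "h = hook_at \<nu> v" "revlex_le u v"
    using assms(2) by (auto simp: hook_le_def)
  obtain u' v' where uv': "u' \<in> \<nu>" "v' \<in> \<nu>" "h = hook_at \<nu> u'" "g = hook_at \<nu> v'" "revlex_le u' v'"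
    using assms(3) by (auto simp: hook_le_def)
  have "u = v'" "v = u'" using inj_onD[OF inj_on_hook_at[OF young]] uv uv' by metis+
  then show ?thesis using revlex_le_antisym uv uv' by metis
qed

lemma image_mset_sum_replicate:
  assumes "finite A"
  shows "image_mset f (\<Sum>u\<in>A. replicate_mset (t u) u) = (\<Sum>u\<in>A. replicate_mset (t u) (f u))"
  using assms by induction auto

text \<open>Evaluates the \<open>THE\<close> in \<open>hook_list\<close>: the sorted list of hooks
  is the image of the sorted list of cells.\<close>

lemma Phi_build:
  assumes young: "young \<nu>" and us: "sorted_wrt revlex_le us" "set us \<subseteq> \<nu>"
    and count: "\<And>u. u \<in> \<nu> \<Longrightarrow> count_list us u = t u"
  shows "Phi \<nu> t = build \<nu> us"
proof -
  have "count (mset us) v = count (\<Sum>u\<in>\<nu>. replicate_mset (t u) u) v" for v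
  proof -
    have "count (\<Sum>u\<in>\<nu>. replicate_mset (t u) u) v = (\<Sum>u\<in>\<nu>. if u = v then t u else 0)"
      by (auto simp: count_sum intro: sum.cong)
    also have "\<dots> = (if v \<in> \<nu> then t v else 0)" using young_finite[OF young] by simp
    also have "\<dots> = count_list us v"
      using count us(2) by (auto simp: count_list_0_iff)
    finally show ?thesis by (simp add: count_mset)
  qed
  then have "mset us = (\<Sum>u\<in>\<nu>. replicate_mset (t u) u)" by (rule multiset_eqI)
  then have mset: "mset (map (hook_at \<nu>) us) = (\<Sum>u\<in>\<nu>. replicate_mset (t u) (hook_at \<nu> u))"
    using image_mset_sum_replicate[OF young_finite[OF young]] by simp
  have sorted: "sorted_wrt (hook_le \<nu>) (map (hook_at \<nu>) us)"
    unfolding sorted_wrt_map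
    by (rule sorted_wrt_mono_rel[OF _ us(1)]) (use us(2) in \<open>auto simp: hook_le_def\<close>)
  have "hook_list \<nu> t = map (hook_at \<nu>) us"
    unfolding hook_list_def
  proof (rule the_equality)
    fix hs assume "mset hs = (\<Sum>u\<in>\<nu>. replicate_mset (t u) (hook_at \<nu> u)) \<and> sorted_wrt (hook_le \<nu>) hs"
    then show "hs = map (hook_at \<nu>) us"
      using sorted_wrt_mset_unique[of hs "hook_le \<nu>"] hook_le_antisym[OF young] sorted mset by metis
  qed (use mset sorted in simp)
  then show ?thesis by (simp add: Phi_def build_def)
qed

lemma ex_cell_list:
  assumes "young \<nu>"
  obtains us where "sorted_wrt revlex_le us" "set us \<subseteq> \<nu>" "\<And>u. u \<in> \<nu> \<Longrightarrow> count_list us u = t u"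
proof -
  note fin = young_finite[OF assms]
  obtain us where us: "mset us = (\<Sum>u\<in>\<nu>. replicate_mset (t u) u)" "sorted_wrt revlex_le us"
    using ex_sorted_revlex by blast
  have count: "count_list us v = (if v \<in> \<nu> then t v else 0)" for v
  proof -
    have "count_list us v = count (\<Sum>u\<in>\<nu>. replicate_mset (t u) u) v" using us(1) by (metis count_mset)
    also have "\<dots> = (\<Sum>u\<in>\<nu>. if u = v then t u else 0)" by (auto simp: count_sum intro: sum.cong)
    finally show ?thesis using fin by simp
  qed
  moreover have "set us \<subseteq> \<nu>"
  proof
    fix v assume "v \<in> set us"
    then have "count_list us v \<noteq> 0" by (simp add: count_list_0_iff)
    then show "v \<in> \<nu>" using count[of v] by (auto split: if_splits)
  qed
  ultimately show ?thesis using that us(2) by simp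
qed

subsection \<open>The two maps are inverse to each other\<close>

lemma Phi_RPP:
  assumes "young \<nu>"
  shows "Phi \<nu> t \<in> RPP \<nu>"
proof -
  obtain us where "sorted_wrt revlex_le us" "set us \<subseteq> \<nu>" "\<And>u. u \<in> \<nu> \<Longrightarrow> count_list us u = t u"
    by (rule ex_cell_list[OF assms, of t]) blast
  then show ?thesis using Phi_build[OF assms] goodD(1)[OF good_young[OF assms]] by metis
qed

lemma count_list_filter: "count_list (filter P xs) u = (if P u then count_list xs u else 0)"
  by (induction xs) auto

text \<open>The commutation freed from lists: the copies of x in the cell list turn into the excess
  \<open>t x\<close>.\<close>

lemma (in corner) Phi_unzeta: "Phi \<nu> t = unzeta (Phi \<mu> (restrict t \<mu>)) (t x)"
proof -
  obtain us where us: "sorted_wrt revlex_le us" "set us \<subseteq> \<nu>" "\<And>u. u \<in> \<nu> \<Longrightarrow> count_list us u = t u"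
    by (rule ex_cell_list[OF young, of t]) blast
  have "Phi \<mu> (restrict t \<mu>) = build \<mu> (filter (\<lambda>u. u \<noteq> x) us)"
  proof (rule Phi_build[OF young_mu])
    show "sorted_wrt revlex_le (filter (\<lambda>u. u \<noteq> x) us)" using us(1) by (rule sorted_wrt_filter)
    show "set (filter (\<lambda>u. u \<noteq> x) us) \<subseteq> \<mu>" using us(2) by auto
    show "count_list (filter (\<lambda>u. u \<noteq> x) us) u = restrict t \<mu> u" if "u \<in> \<mu>" for u
      using that us(3) by (simp add: count_list_filter)
  qed
  then show ?thesis
    using Phi_build[OF young us] build_unzeta[OF good_young[OF young_mu] us(1,2)] us(3)[OF corner_mem] by simp
qed

lemma (in corner) zeta_Phi: "zeta \<nu> x (Phi \<nu> t) = Phi \<mu> (restrict t \<mu>)"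
  unfolding Phi_unzeta by (rule zeta_unzeta[OF Phi_RPP[OF young_mu]])

lemma (in corner) corner_value_Phi:
  "the_enat (val \<nu> (Phi \<nu> t) x - max (val \<nu> (Phi \<nu> t) (north x)) (val \<nu> (Phi \<nu> t) (west x))) = t x"
proof -
  have "Phi \<nu> t x - nw_max (Phi \<nu> t) x = t x"
    unfolding Phi_unzeta by (rule corner_value_unzeta[OF Phi_RPP[OF young_mu]])
  then show ?thesis unfolding corner_value[OF Phi_RPP[OF young]] .
qed

text \<open>By induction over the derivation, whose corners are arbitrary: each removed corner gives
  back its entry of t, and what is left is \<open>Phi\<close> of the restricted tableau. With
  \<open>Phi_surj\<close> this covers every reverse plane partition.\<close>

lemma xi_rel_unique:
  "xi_rel \<nu> \<pi> s \<Longrightarrow> young \<nu> \<Longrightarrow> t \<in> Tab \<nu> \<Longrightarrow> \<pi> = Phi \<nu> t \<Longrightarrow> s = t"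
proof (induction arbitrary: t rule: xi_rel.induct)
  case (empty \<pi>)
  then show ?case by (simp add: Tab_def)
next
  case (corner \<nu> x \<pi> s)
  obtain a b where x: "x = (a, b)" by fastforce
  interpret corner \<nu> a b using corner_locale[OF corner.prems(1) corner.hyps(1)] by (simp add: x)
  have "s = restrict t (\<nu> - {x})"
  proof (rule corner.IH)
    show "young (\<nu> - {x})" using young_mu by (simp add: x)
    show "restrict t (\<nu> - {x}) \<in> Tab (\<nu> - {x})" by (simp add: Tab_def)
    show "zeta \<nu> x \<pi> = Phi (\<nu> - {x}) (restrict t (\<nu> - {x}))"
      using zeta_Phi corner.prems(3) by (simp add: x)
  qed
  then have "s(x := t x) = t"
    using TabD[OF corner.prems(2)] by (auto simp: fun_eq_iff)
  then show ?case using corner_value_Phi[of t] corner.prems(3) by (simp add: x)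
qed

lemma xi_rel_exists: "young \<nu> \<Longrightarrow> \<exists>t. xi_rel \<nu> \<pi> t"
proof (induction "card \<nu>" arbitrary: \<nu> \<pi> rule: less_induct)
  case less
  show ?case
  proof (cases "\<nu> = {}")
    case True
    then show ?thesis using xi_rel.empty by blast
  next
    case False
    then obtain x where x: "outer_corner \<nu> x" using ex_outer_corner[OF less.prems] by blast
    then have "card (\<nu> - {x}) < card \<nu>"
      using young_finite[OF less.prems] by (intro psubset_card_mono) (auto simp: outer_corner_def)
    then show ?thesis
      using less.hyps[of "\<nu> - {x}"] young_remove_corner[OF less.prems x] xi_rel.corner[OF x] by blast
  qed
qed

lemma xi_Phi:
  assumes "young \<nu>" "t \<in> Tab \<nu>"
  shows "xi \<nu> (Phi \<nu> t) = t"
  unfolding xi_def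
  using xi_rel_exists[OF assms(1)] xi_rel_unique[OF _ assms] by (metis theI)

text \<open>A preimage of \<pi> is a preimage of its image under \<open>zeta\<close>, completed at x
  by the excess of \<pi>.\<close>

lemma Phi_surj: "young \<nu> \<Longrightarrow> \<pi> \<in> RPP \<nu> \<Longrightarrow> \<exists>t\<in>Tab \<nu>. Phi \<nu> t = \<pi>"
proof (induction "card \<nu>" arbitrary: \<nu> \<pi> rule: less_induct)
  case less
  show ?case
  proof (cases "\<nu> = {}")
    case True
    have "Phi \<nu> (\<lambda>_. undefined) \<in> Tab \<nu>" using RPP_Tab[OF Phi_RPP[OF less.prems(1)]] .
    then show ?thesis using True RPP_Tab[OF less.prems(2)] by (auto simp: Tab_def)
  next
    case False
    then obtain x where x: "outer_corner \<nu> x" using ex_outer_corner[OF less.prems(1)] by blast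
    obtain a b where ab: "x = (a, b)" by fastforce
    interpret corner \<nu> a b using corner_locale[OF less.prems(1) x] by (simp add: ab)
    have "card \<mu> < card \<nu>"
      using young_finite[OF young] corner_mem by (intro psubset_card_mono) auto
    then obtain s where s: "s \<in> Tab \<mu>" "Phi \<mu> s = zeta \<nu> (a, b) \<pi>"
      using less.hyps[OF _ young_mu zeta_RPP[OF less.prems(2)]] by blast
    define t where "t = s((a, b) := \<pi> (a, b) - nw_max \<pi> (a, b))"
    have "restrict t \<mu> = s" using TabD[OF s(1)] by (auto simp: t_def restrict_def fun_eq_iff)
    then have "Phi \<nu> t = \<pi>"
      using Phi_unzeta[of t] s(2) unzeta_zeta[OF less.prems(2)] by (simp add: t_def)
    moreover have "t \<in> Tab \<nu>"
      using TabD[OF s(1)] corner_mem by (auto simp: t_def Tab_def PiE_def extensional_def)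
    ultimately show ?thesis by blast
  qed
qed

theorem mainTheorem19:
  fixes lam :: "nat list"
  assumes "is_partition lam"
  shows "bij_betw (Phi (diagram lam)) (Tab (diagram lam)) (RPP (diagram lam)) \<and>
    bij_betw (xi (diagram lam)) (RPP (diagram lam)) (Tab (diagram lam)) \<and>
    (\<forall>t\<in>Tab (diagram lam). xi (diagram lam) (Phi (diagram lam) t) = t) \<and>
    (\<forall>\<pi>\<in>RPP (diagram lam). Phi (diagram lam) (xi (diagram lam) \<pi>) = \<pi>)"
proof -
  let ?\<nu> = "diagram lam"
  note young = young_diagram[OF assms]
  note xi_Phi = xi_Phi[OF young]
  have Phi_xi: "xi ?\<nu> \<pi> \<in> Tab ?\<nu> \<and> Phi ?\<nu> (xi ?\<nu> \<pi>) = \<pi>" if "\<pi> \<in> RPP ?\<nu>" for \<pi>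
    using Phi_surj[OF young that] xi_Phi by auto
  have "bij_betw (Phi ?\<nu>) (Tab ?\<nu>) (RPP ?\<nu>)"
    by (rule bij_betw_byWitness[of _ "xi ?\<nu>"]) (use xi_Phi Phi_xi Phi_RPP[OF young] in auto)
  moreover have "bij_betw (xi ?\<nu>) (RPP ?\<nu>) (Tab ?\<nu>)"
    by (rule bij_betw_byWitness[of _ "Phi ?\<nu>"]) (use xi_Phi Phi_xi Phi_RPP[OF young] in auto)
  ultimately show ?thesis using xi_Phi Phi_xi by blast
qed

end
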